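(* Let $N\in\mathbb{Z}_+$, $\overline v>0$, and $\overline s=n\overline v$ for some $n\in\mathbb{Z}_+$. Consider the finite-horizon storage management problem $$\min\ \mathbf{E}\Big[\sum_{k=0}^{N-1}\{h_k(s_k)+\lambda_k v_k\}-\hat t\,s_N\Big]\quad\text{s.t.}\quad s_{k+1}=s_k+v_k,\ \ s_k\in[0,\overline s],\ \ v_k\in[-\overline v,\overline v],$$ where the prices $\lambda_k$ are exogenous and independently distributed according to probability mass functions $P_k$. Assume that the penalty functions $h_k:[0,\infty)\to[0,\infty)$, $k=0,\dots,N$, are piecewise linear non-decreasing convex functions of the form $$h_k(s)=h_k^i s+c_k^i,\qquad s\in[i\overline v,(i+1)\overline v),\ i\in\overline{\mathbb{Z}}_+,$$ where the capacity bound $\overline s$ is enforced by taking $h_k^i>\lambda_k^{\max}$ for all $i\ge n$. Then: (i) The optimal policy is characterized as follows: if $s_k\in[i\overline v,(i+1)\overline v)$ for some $i\in\overline{\mathbb{Z}}_+$, then $$v_k^\ast=\begin{cases}\max(-s_k,-\overline v), & t_{k+1}^{\max(0,i-1)}<\lambda_k \quad(\text{for all } i),\\ i\overline v-s_k, & t_{k+1}^i<\lambda_k\le t_{k+1}^{i-1}\quad(\text{for } i\ge1),\\ (i+1)\overline v-s_k, & t_{k+1}^{i+1}<\lambda_k\le t_{k+1}^i\quad(\text{for all } i),\\ \overline v, & \lambda_k\le t_{k+1}^{i+1}\quad(\text{for all } i),\end{cases}$$ where the thresholds are computed via the recursive equations $$t_N^i=\hat t\ \ (i\in\{0,1,\dots,n-1\}),\qquad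 t_N^i=-h_N^i\ \ (i\ge n),$$ and for $k<N$ $$t_k^0=t_{k+1}^1+\Phi_k^1(t_{k+1}^1,\lambda_k^{\max}]-h_k^0,$$ $$t_k^i=t_{k+1}^{i-1}-h_k^i+\Phi_k^1(t_{k+1}^{i+1},t_{k+1}^{i-1}]+(t_{k+1}^{i+1}-t_{k+1}^{i-1})F_k(t_{k+1}^{i-1}),\qquad i\ge 1.$$ (ii) The value function is a piecewise linear convex function of the form $$V_k(s)=-t_k^i s+e_k^i,\qquad s\in[i\overline v,(i+1)\overline v),\ i\in\overline{\mathbb{Z}}_+,$$ where $t_k^i$ are the thresholds above and the intercepts $e_k^i$ are computed via the recursive equations $$e_N^i=0\ \ (i\in\{0,1,\dots,n-1\}),\qquad e_N^i=\overline s\,(t_N^i-\hat t)\ \ (i\ge n),$$ and for $k<N$ $$e_k^0=c_k^0+e_{k+1}^0+\big(\overline v\lambda_k^{\min}+e_{k+1}^1-e_{k+1}^0-\overline v t_{k+1}^1\big)F_k(t_{k+1}^0),$$ $$e_k^i=c_k^i+\overline v\,\overline\lambda_k+f_k^i+g_k^i,\qquad i\ge1,$$ with $$f_k^i=e_{k+1}^{i-1}-\overline v t_{k+1}^{i+1}+(e_{k+1}^i-e_{k+1}^{i-1})F_k(t_{k+1}^{i-1})+(e_{k+1}^{i+1}-e_{k+1}^i)F_k(t_{k+1}^i),$$ $$g_k^i=(i+1)\Phi_k^{\overline v}(t_{k+1}^{i+1},t_{k+1}^i]+i\,\Phi_k^{\overline v}(t_{k+1}^i,t_{k+1}^{i-1}]-\Phi_k^{\overline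 v}(t_{k+1}^{i-1},\lambda_k^{\max}]-\Phi_k^{\overline v}(t_{k+1}^{i+1},\lambda_k^{\max}].$$
   Context: $\mathbb{Z}_+$ denotes the positive integers and $\overline{\mathbb{Z}}_+$ the non-negative integers. For $k=0,\dots,N$, $P_k$ is the probability mass function of the price $\lambda_k$, with support in $[\lambda_k^{\min},\lambda_k^{\max}]\subset[0,\infty)$; $F_k$ is its cumulative distribution function and $\overline\lambda_k$ its mean. Prices are independent across time; their distributions may differ across stages and are known a priori. The price $\lambda_k$ is revealed before $v_k$ is chosen. The salvage value per unit of energy left at the end of the horizon is $\hat t\in[\lambda_N^{\min},\lambda_N^{\max}]$. The value function is $V_k(s)=\mathbf{E}[J_k(s)]$, the optimal expected cost-to-go from storage level $s$ at stage $k$ before $\lambda_k$ is revealed, where for $k<N$ $$J_k(s)=h_k(s)+\min_{v\in[\max(-s,-\overline v),\overline v]}\{\lambda_k v+V_{k+1}(s+v)\}.$$ At the terminal stage $V_N(s)=-\hat t s$ for $s\le\overline s$, and beyond $\overline s$ it is $V_N(s)=-t_N^i s+e_N^i$ with the values of $t_N^i,e_N^i$ ($i\ge n$) given in the claim. Thus the capacity limit is imposed through the large penalty slopes for $i\ge n$, rather than as an explicit constraint in the minimization. For a set $I$ put $\Theta_k(I)=\sum_{\theta\in I}\theta P_k(\theta)$ and $\psi_k(I)=\sum_{\theta\in I}P_k(\theta)$. For $w>0$ (used with $w=1$ and $w=\overline v$) define $\Phi_k^{w}(I)=w\,(\Theta_k(I)-\rho\,\psi_k(I))$ with $\rho=\inf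 I$. The notation $\Phi_k^w(a,b]$ means $\Phi_k^w$ applied to the interval $(a,b]$, with $\rho=a$; it is $0$ if the interval is empty.
   Formalization: The printed recursion for e_k^0 is false; the term Φ_k^{v̄}[λ_k^min, t_{k+1}^0] is added. Convexity of V_k on all of [0,∞) is false if h_N^i varies over i≥n; it is claimed on [0, s̄+v̄] always and on [0,∞) when h_N^i is constant for i≥n. *)

theory Defs
  imports "HOL-Probability.Probability"
begin

record storage =
  horizon :: nat
  rate :: real
  blocks :: nat
  price :: "nat \<Rightarrow> real pmf"
  price_min :: "nat \<Rightarrow> real"
  price_max :: "nat \<Rightarrow> real"
  penalty :: "nat \<Rightarrow> real \<Rightarrow> real"
  slope :: "nat \<Rightarrow> nat \<Rightarrow> real"
  icpt :: "nat \<Rightarrow> nat \<Rightarrow> real"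
  salvage :: real

definition capacity :: "storage \<Rightarrow> real" where
  "capacity M = real (blocks M) * rate M"

definition segment :: "storage \<Rightarrow> nat \<Rightarrow> real set" where
  "segment M i = {real i * rate M..<(real i + 1) * rate M}"

definition segment_of :: "storage \<Rightarrow> real \<Rightarrow> nat" where
  "segment_of M s = nat \<lfloor>s / rate M\<rfloor>"

definition Theta :: "real pmf \<Rightarrow> real set \<Rightarrow> real" where
  "Theta p I = (\<Sum>\<^sub>\<infinity>\<theta>\<in>I. \<theta> * pmf p \<theta>)"

definition psi :: "real pmf \<Rightarrow> real set \<Rightarrow> real" where
  "psi p I = (\<Sum>\<^sub>\<infinity>\<theta>\<in>I. pmf p \<theta>)"

(* For I = {} both sums vanish, so the value is 0 whatever Inf {} is. *)
definition Phi :: "real pmf \<Rightarrow> real \<Rightarrow> real set \<Rightarrow> real" where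
  "Phi p w I = w * (Theta p I - Inf I * psi p I)"

definition mean_price :: "storage \<Rightarrow> nat \<Rightarrow> real" where
  "mean_price M k = measure_pmf.expectation (price M k) (\<lambda>\<theta>. \<theta>)"

function thr :: "storage \<Rightarrow> nat \<Rightarrow> nat \<Rightarrow> real" where
  "thr M k i =
    (if k \<ge> horizon M then (if i < blocks M then salvage M else - slope M (horizon M) i)
     else if i = 0 then
       thr M (k + 1) 1 + Phi (price M k) 1 {thr M (k + 1) 1<..price_max M k} - slope M k 0
     else
       thr M (k + 1) (i - 1) - slope M k i
       + Phi (price M k) 1 {thr M (k + 1) (i + 1)<..thr M (k + 1) (i - 1)}
       + (thr M (k + 1) (i + 1) - thr M (k + 1) (i - 1))
         * cdf (price M k) (thr M (k + 1) (i - 1)))"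
  by pat_completeness auto
termination by (relation "Wellfounded.measure (\<lambda>(M, k, i). horizon M - k)") auto

declare thr.simps [simp del]

(* In the case i = 0 the term Phi ... {price_min M k..thr M (k + 1) 0} is needed: together with
   rate M * price_min M k * cdf ... it amounts to rate M * Theta ... {..thr M (k + 1) 0}, the
   expected cost of buying one block when the price does not exceed the threshold. *)
function intercept :: "storage \<Rightarrow> nat \<Rightarrow> nat \<Rightarrow> real" where
  "intercept M k i =
    (if k \<ge> horizon M then
       (if i < blocks M then 0 else capacity M * (thr M (horizon M) i - salvage M))
     else if i = 0 then
       icpt M k 0 + intercept M (k + 1) 0
       + Phi (price M k) (rate M) {price_min M k..thr M (k + 1) 0}
       + (rate M * price_min M k + intercept M (k + 1) 1 - intercept M (k + 1) 0
          - rate M * thr M (k + 1) 1) * cdf (price M k) (thr M (k + 1) 0)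
     else
       let f = intercept M (k + 1) (i - 1) - rate M * thr M (k + 1) (i + 1)
             + (intercept M (k + 1) i - intercept M (k + 1) (i - 1))
               * cdf (price M k) (thr M (k + 1) (i - 1))
             + (intercept M (k + 1) (i + 1) - intercept M (k + 1) i)
               * cdf (price M k) (thr M (k + 1) i);
           g = (real i + 1) * Phi (price M k) (rate M) {thr M (k + 1) (i + 1)<..thr M (k + 1) i}
             + real i * Phi (price M k) (rate M) {thr M (k + 1) i<..thr M (k + 1) (i - 1)}
             - Phi (price M k) (rate M) {thr M (k + 1) (i - 1)<..price_max M k}
             - Phi (price M k) (rate M) {thr M (k + 1) (i + 1)<..price_max M k}
       in icpt M k i + rate M * mean_price M k + f + g)"
  by pat_completeness auto
termination by (relation "Wellfounded.measure (\<lambda>(M, k, i). horizon M - k)") auto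

declare intercept.simps [simp del]

definition controls :: "storage \<Rightarrow> real \<Rightarrow> real set" where
  "controls M s = {max (- s) (- rate M)..rate M}"

definition terminal_value :: "storage \<Rightarrow> real \<Rightarrow> real" where
  "terminal_value M s =
    (if s \<le> capacity M then - salvage M * s
     else - thr M (horizon M) (segment_of M s) * s + intercept M (horizon M) (segment_of M s))"

(* The capacity is not a constraint of the inner minimization; only the penalty slopes enforce it. *)
function V :: "storage \<Rightarrow> nat \<Rightarrow> real \<Rightarrow> real" where
  "V M k s =
    (if k \<ge> horizon M then terminal_value M s
     else measure_pmf.expectation (price M k)
       (\<lambda>l. penalty M k s + (INF v\<in>controls M s. l * v + V M (k + 1) (s + v))))"
  by pat_completeness auto
termination by (relation "Wellfounded.measure (\<lambda>(M, k, s). horizon M - k)") auto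

declare V.simps [simp del]

(* With i - 1 truncated at 0, the first case reads thr M (k + 1) (max 0 (i - 1)) < l. *)
definition threshold_control :: "storage \<Rightarrow> nat \<Rightarrow> real \<Rightarrow> real \<Rightarrow> real" where
  "threshold_control M k s l =
    (let i = segment_of M s in
     if thr M (k + 1) (i - 1) < l then max (- s) (- rate M)
     else if i \<ge> 1 \<and> thr M (k + 1) i < l \<and> l \<le> thr M (k + 1) (i - 1) then real i * rate M - s
     else if thr M (k + 1) (i + 1) < l \<and> l \<le> thr M (k + 1) i then (real i + 1) * rate M - s
     else rate M)"

(* A policy maps the stage and the price path to a control. *)
type_synonym policy = "nat \<Rightarrow> (nat \<Rightarrow> real) \<Rightarrow> real"

primrec level :: "real \<Rightarrow> policy \<Rightarrow> (nat \<Rightarrow> real) \<Rightarrow> nat \<Rightarrow> real" where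
  "level s0 \<pi> w 0 = s0"
| "level s0 \<pi> w (Suc k) = level s0 \<pi> w k + \<pi> k w"

definition price_path :: "storage \<Rightarrow> (nat \<Rightarrow> real) pmf" where
  "price_path M = Pi_pmf {..<horizon M} 0 (price M)"

definition feasible_policy :: "storage \<Rightarrow> real \<Rightarrow> policy \<Rightarrow> bool" where
  "feasible_policy M s0 \<pi> \<longleftrightarrow>
    (\<forall>k<horizon M. \<forall>w w'. (\<forall>j\<le>k. w j = w' j) \<longrightarrow> \<pi> k w = \<pi> k w') \<and>
    (\<forall>w\<in>set_pmf (price_path M).
       (\<forall>k<horizon M. \<pi> k w \<in> {- rate M..rate M}) \<and>
       (\<forall>k\<le>horizon M. level s0 \<pi> w k \<in> {0..capacity M}))"

definition expected_cost :: "storage \<Rightarrow> real \<Rightarrow> policy \<Rightarrow> real" where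
  "expected_cost M s0 \<pi> = measure_pmf.expectation (price_path M)
     (\<lambda>w. (\<Sum>k<horizon M. penalty M k (level s0 \<pi> w k) + w k * \<pi> k w)
          - salvage M * level s0 \<pi> w (horizon M))"

definition optimal_policy :: "storage \<Rightarrow> real \<Rightarrow> policy \<Rightarrow> bool" where
  "optimal_policy M s0 = is_arg_min (expected_cost M s0) (feasible_policy M s0)"

primrec threshold_level :: "storage \<Rightarrow> real \<Rightarrow> (nat \<Rightarrow> real) \<Rightarrow> nat \<Rightarrow> real" where
  "threshold_level M s0 w 0 = s0"
| "threshold_level M s0 w (Suc k) =
     threshold_level M s0 w k + threshold_control M k (threshold_level M s0 w k) (w k)"

definition threshold_policy :: "storage \<Rightarrow> real \<Rightarrow> policy" where
  "threshold_policy M s0 k w = threshold_control M k (threshold_level M s0 w k) (w k)"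

end

theory Submission
  imports Defs
begin

text \<open>
  Write $r$ for the rate and $n$ for the number of blocks, so that the capacity is $n r$. The proof is
  a backward induction on a single invariant, \<open>well_shaped\<close>: on the $i$-th segment
  $V_k$ is the affine function $-t_k^i s + e_k^i$; the thresholds decrease in $i$ and are negative for
  $i \ge n$; adjacent affine pieces meet at the breakpoints up to the capacity, while at later
  breakpoints $V_k$ may jump upwards. The jumps really occur, already for $V_N$ at $(n+1)r$ when the
  penalty gets steeper there, and therefore convexity is not part of the invariant.

  Given the invariant at stage $k+1$, every affine piece up to the $n$-th one lies below $V_{k+1}$
  (\<open>pieces.piece_below\<close>) and the others lie below it to the right of their left end
  point. So $\lambda v + V_{k+1}(s+v)$ decreases while the threshold exceeds $\lambda$ and increases
  afterwards, and the minimum over a window of radius $r$ is where the threshold crosses $\lambda$, or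
  at the end of the window nearest to that crossing: this is the threshold control. As
  $\lambda \ge 0$ and the thresholds beyond the capacity are negative, buying never leads beyond the
  capacity, which is why the upward jumps do no harm and why the capacity constraint holds without
  being imposed.

  Inserting the control, the minimum is an explicit function of $\lambda$ on each segment
  (\<open>trade_cost\<close>). The recursion for $t$ and $e$ is its expectation, term by term:
  $\Phi$, $F$ and the mean price are the expectations of truncated differences, indicators and the
  identity (\<open>line_expectation\<close>). In particular
  $t_k^i = -h_k^i + \mathbf{E}[\min(t_{k+1}^{i-1}, \max(\lambda_k, t_{k+1}^{i+1}))]$
  for $i \ge 1$ (\<open>thr_expectation\<close>), from which the order and the sign of the thresholds at stage $k$
  are immediate. The affine pieces at stage $k$ meet because, price by price, the two neighbouring
  formulas for the minimum agree at a breakpoint within the capacity (\<open>trade_cost_at_breakpoint\<close>).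

  Optimality among all adapted policies is the usual verification argument: the expectation of the
  cost incurred before stage $k$ plus $V_k$ at the current level is non-decreasing in $k$ for every
  feasible policy and constant for the threshold policy (\<open>anticipated_cost_mono\<close>).
  Independence of the prices enters through \<open>expectation_Pi_pmf_resample\<close>.
\<close>

section \<open>Expectations under a price distribution of bounded support\<close>

text \<open>
  Expectations are handled through \<open>has_bochner_integral\<close>, which carries integrability and
  value together, so that linear combinations are evaluated by introduction rules alone.
\<close>

lemma has_expectation:
  fixes f :: "'a \<Rightarrow> real"
  assumes "\<And>x. x \<in> set_pmf p \<Longrightarrow> \<bar>f x\<bar> \<le> B"
  shows "has_bochner_integral (measure_pmf p) f (measure_pmf.expectation p f)"
  unfolding has_bochner_integral_iff
  using measure_pmf.integrable_const_bound[where f = f and B = B and M = p] assms by (simp add: AE_measure_pmf_iff)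

lemma has_expectation_cong:
  fixes f :: "'a \<Rightarrow> real"
  assumes "has_bochner_integral (measure_pmf p) f c" "\<And>x. x \<in> set_pmf p \<Longrightarrow> f x = g x" "c = d"
  shows "has_bochner_integral (measure_pmf p) g d"
  using has_bochner_integral_cong_AE[of f "measure_pmf p" g c] assms by (simp add: AE_measure_pmf_iff)

lemma has_expectation_mono:
  fixes f g :: "'a \<Rightarrow> real"
  assumes "has_bochner_integral (measure_pmf p) f a" "has_bochner_integral (measure_pmf p) g b"
    and "\<And>x. x \<in> set_pmf p \<Longrightarrow> f x \<le> g x"
  shows "a \<le> b"
proof -
  have "measure_pmf.expectation p f \<le> measure_pmf.expectation p g"
    using assms by (intro integral_mono_AE) (auto simp: has_bochner_integral_iff AE_measure_pmf_iff)
  then show ?thesis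
    using assms(1,2) by (simp add: has_bochner_integral_iff)
qed

lemma has_expectation_const: "has_bochner_integral (measure_pmf p) (\<lambda>_. c) (c :: real)"
  by (simp add: has_bochner_integral_iff)

lemma has_expectation_scale:
  fixes f :: "'a \<Rightarrow> real"
  shows "has_bochner_integral (measure_pmf p) f x \<Longrightarrow> has_bochner_integral (measure_pmf p) (\<lambda>y. c * f y) (c * x)"
  by (rule has_bochner_integral_mult_right) simp

lemmas has_expectation_intros = has_bochner_integral_add has_bochner_integral_diff
  has_expectation_scale has_expectation_const

lemma prob_expectation:
  "has_bochner_integral (measure_pmf p) (indicator A :: _ \<Rightarrow> real) (measure_pmf.prob p A)"
  by (intro has_bochner_integral_real_indicator) (auto simp: less_top[symmetric])

lemma psi_eq_prob: "psi p I = measure_pmf.prob p I"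
  unfolding psi_def by (metis infsetsum_infsum measure_pmf_conv_infsetsum pmf_abs_summable)

lemma Theta_eq_expectation:
  assumes "set_pmf p \<subseteq> {a..b}"
  shows "Theta p I = measure_pmf.expectation p (\<lambda>\<theta>. \<theta> * indicator I \<theta>)"
proof -
  let ?B = "max \<bar>a\<bar> \<bar>b\<bar>"
  have summ: "Infinite_Set_Sum.abs_summable_on (\<lambda>\<theta>. \<theta> * pmf p \<theta>) I"
  proof (rule abs_summable_on_comparison_test)
    show "Infinite_Set_Sum.abs_summable_on (\<lambda>\<theta>. ?B * pmf p \<theta>) I"
      by (intro abs_summable_on_cmult_right pmf_abs_summable)
    fix \<theta> assume "\<theta> \<in> I"
    show "norm (\<theta> * pmf p \<theta>) \<le> norm (?B * pmf p \<theta>)"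
    proof (cases "\<theta> \<in> set_pmf p")
      case True
      then have "\<bar>\<theta>\<bar> \<le> ?B" using assms by fastforce
      then show ?thesis by (simp add: abs_mult mult_right_mono)
    next
      case False
      then have "pmf p \<theta> = 0" by (simp add: pmf_eq_0_set_pmf)
      then show ?thesis by simp
    qed
  qed
  have "Theta p I = infsetsum (\<lambda>\<theta>. \<theta> * pmf p \<theta>) I"
    unfolding Theta_def using infsetsum_infsum[OF summ] by simp
  also have "\<dots> = infsetsum (\<lambda>\<theta>. pmf p \<theta> * (\<theta> * indicator I \<theta>)) UNIV"
    by (rule infsetsum_cong_neutral) (auto simp: mult.commute)
  finally show ?thesis by (simp add: pmf_expectation_eq_infsetsum)
qed

lemma Phi_Ioc_expectation:
  assumes "set_pmf p \<subseteq> {lo..hi}"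
  shows "has_bochner_integral (measure_pmf p) (\<lambda>\<theta>. w * ((\<theta> - a) * indicator {a<..b} \<theta>)) (Phi p w {a<..b})"
proof -
  have "has_bochner_integral (measure_pmf p) (\<lambda>\<theta>. \<theta> * indicator {a<..b} \<theta>) (Theta p {a<..b})"
    unfolding Theta_eq_expectation[OF assms] using assms
    by (intro has_expectation[where B = "max \<bar>lo\<bar> \<bar>hi\<bar>"]) (fastforce simp: indicator_def)
  moreover have "has_bochner_integral (measure_pmf p) (indicator {a<..b}) (psi p {a<..b})"
    unfolding psi_eq_prob by (rule prob_expectation)
  ultimately have "has_bochner_integral (measure_pmf p)
      (\<lambda>\<theta>. w * (\<theta> * indicator {a<..b} \<theta> - Inf {a<..b} * indicator {a<..b} \<theta>)) (Phi p w {a<..b})"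
    unfolding Phi_def by (intro has_bochner_integral_mult_right has_bochner_integral_diff)
  then show ?thesis
    by (rule has_expectation_cong) (auto simp: indicator_def algebra_simps)
qed

text \<open>
  The interval that ends at the upper end of the support cuts nothing off from above, so here \<open>Phi\<close>
  is the expected excess of the price over \<open>a\<close>; the identity also holds when the interval is empty.
\<close>

lemma Phi_tail_expectation:
  assumes "set_pmf p \<subseteq> {lo..hi}"
  shows "has_bochner_integral (measure_pmf p) (\<lambda>\<theta>. w * max 0 (\<theta> - a)) (Phi p w {a<..hi})"
  by (rule has_expectation_cong[OF Phi_Ioc_expectation[OF assms]])
    (use assms in \<open>auto simp: indicator_def max_def\<close>)

lemma Phi_initial_expectation:
  assumes "set_pmf p \<subseteq> {lo..hi}"
  shows "has_bochner_integral (measure_pmf p) (\<lambda>\<theta>. w * ((\<theta> - lo) * indicator {..b} \<theta>)) (Phi p w {lo..b})"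
proof -
  have "has_bochner_integral (measure_pmf p) (\<lambda>\<theta>. \<theta> * indicator {lo..b} \<theta>) (Theta p {lo..b})"
    unfolding Theta_eq_expectation[OF assms] using assms
    by (intro has_expectation[where B = "max \<bar>lo\<bar> \<bar>hi\<bar>"]) (fastforce simp: indicator_def)
  moreover have "has_bochner_integral (measure_pmf p) (indicator {lo..b}) (psi p {lo..b})"
    unfolding psi_eq_prob by (rule prob_expectation)
  ultimately have "has_bochner_integral (measure_pmf p)
      (\<lambda>\<theta>. w * (\<theta> * indicator {lo..b} \<theta> - Inf {lo..b} * indicator {lo..b} \<theta>)) (Phi p w {lo..b})"
    unfolding Phi_def by (intro has_bochner_integral_mult_right has_bochner_integral_diff)
  then show ?thesis
  proof (rule has_expectation_cong)
    fix \<theta> assume "\<theta> \<in> set_pmf p"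
    then have "lo \<le> \<theta>" using assms by auto
    then show "w * (\<theta> * indicator {lo..b} \<theta> - Inf {lo..b} * indicator {lo..b} \<theta>)
        = w * ((\<theta> - lo) * indicator {..b} \<theta>)"
      by (cases "\<theta> \<le> b") (auto simp: algebra_simps)
  qed simp
qed

lemma cdf_expectation:
  "has_bochner_integral (measure_pmf p) (indicator {..b}) (cdf (measure_pmf p) b)"
  unfolding cdf_def by (rule prob_expectation)

text \<open>
  The function need only be bounded on the support of the compound distribution; outside it is
  replaced by zero to meet the global bound that integration against a kernel asks for.
\<close>

lemma expectation_bind_pmf:
  fixes f :: "'b \<Rightarrow> real"
  assumes "\<And>x. x \<in> set_pmf (bind_pmf p q) \<Longrightarrow> \<bar>f x\<bar> \<le> B"
  shows "measure_pmf.expectation (bind_pmf p q) f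
    = measure_pmf.expectation p (\<lambda>x. measure_pmf.expectation (q x) f)"
proof -
  define g where "g x = (if x \<in> set_pmf (bind_pmf p q) then f x else 0)" for x
  have "measure_pmf.expectation (bind_pmf p q) f = measure_pmf.expectation (bind_pmf p q) g"
    by (intro integral_cong_AE) (auto simp: AE_measure_pmf_iff g_def)
  also have "\<dots> = measure_pmf.expectation p (\<lambda>x. measure_pmf.expectation (q x) g)"
    unfolding measure_pmf_bind
  proof (rule integral_bind[where K = "count_space UNIV" and B' = 1 and B = "max 0 B"])
    show "(\<lambda>x. measure_pmf (q x)) \<in> measurable (measure_pmf p) (subprob_algebra (count_space UNIV))"
      using measurable_measure_pmf[of q] by simp
  qed (use assms in \<open>auto simp: g_def measure_pmf.emeasure_space_1 measure_pmf.finite_measure_axioms le_max_iff_disj\<close>)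
  also have "\<dots> = measure_pmf.expectation p (\<lambda>x. measure_pmf.expectation (q x) f)"
    by (intro integral_cong_AE) (auto simp: AE_measure_pmf_iff g_def intro!: integral_cong_AE)
  finally show ?thesis .
qed

text \<open>
  Independence in the form used below: as \<open>g w\<close> does not depend on \<open>w k\<close>, the coordinate \<open>k\<close> may be
  averaged out before the others. Splitting the product at coordinate \<open>k\<close> turns both sides into the
  same iterated expectation.
\<close>

lemma expectation_Pi_pmf_resample:
  fixes g :: "('a \<Rightarrow> 'b) \<Rightarrow> 'b \<Rightarrow> real"
  assumes "finite I" "k \<in> I"
    and local: "\<And>w y z. g (w(k := y)) z = g w z"
    and bound: "\<And>w y. w \<in> set_pmf (Pi_pmf I d p) \<Longrightarrow> y \<in> set_pmf (p k) \<Longrightarrow> \<bar>g w y\<bar> \<le> B"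
  shows "measure_pmf.expectation (Pi_pmf I d p) (\<lambda>w. g w (w k))
    = measure_pmf.expectation (Pi_pmf I d p) (\<lambda>w. measure_pmf.expectation (p k) (g w))"
proof -
  have local': "g (w(k := y)) = g w" for w y
    using local by blast
  let ?Q = "Pi_pmf (I - {k}) d p"
  have split: "Pi_pmf I d p = bind_pmf ?Q (\<lambda>w. map_pmf (\<lambda>y. w(k := y)) (p k))"
    using Pi_pmf_insert'[of "I - {k}" k d p] assms(1,2)
    by (simp add: insert_absorb map_pmf_def bind_commute_pmf[of "p k"])
  have supp: "w(k := y) \<in> set_pmf (Pi_pmf I d p)" if "w \<in> set_pmf ?Q" "y \<in> set_pmf (p k)" for w y
    using that by (auto simp: split)
  have memk: "w k \<in> set_pmf (p k)" if "w \<in> set_pmf (Pi_pmf I d p)" for w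
    using that by (auto simp: split)
  have bound': "\<bar>measure_pmf.expectation (p k) (g w)\<bar> \<le> B" if "w \<in> set_pmf (Pi_pmf I d p)" for w
  proof -
    have int: "has_bochner_integral (measure_pmf (p k)) (g w) (measure_pmf.expectation (p k) (g w))"
      by (rule has_expectation) (use bound[OF that] in auto)
    show ?thesis
      using has_expectation_mono[OF int has_expectation_const[of _ B]]
        has_expectation_mono[OF has_expectation_const[of _ "- B"] int] bound[OF that]
      by (fastforce simp: abs_le_iff)
  qed
  have "measure_pmf.expectation (Pi_pmf I d p) (\<lambda>w. g w (w k))
      = measure_pmf.expectation ?Q (\<lambda>w. measure_pmf.expectation (p k) (g w))"
    unfolding split using expectation_bind_pmf[of ?Q "\<lambda>w. map_pmf (\<lambda>y. w(k := y)) (p k)" "\<lambda>w. g w (w k)" B]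
      bound memk by (simp add: split[symmetric] local')
  also have "\<dots> = measure_pmf.expectation (Pi_pmf I d p) (\<lambda>w. measure_pmf.expectation (p k) (g w))"
    unfolding split
    using expectation_bind_pmf[of ?Q "\<lambda>w. map_pmf (\<lambda>y. w(k := y)) (p k)"
        "\<lambda>w. measure_pmf.expectation (p k) (g w)" B] bound' by (simp add: split[symmetric] local')
  finally show ?thesis .
qed

section \<open>Piecewise linear functions with non-decreasing slopes\<close>

definition affine_piece :: "(nat \<Rightarrow> real) \<Rightarrow> (nat \<Rightarrow> real) \<Rightarrow> nat \<Rightarrow> real \<Rightarrow> real" where
  "affine_piece t e i s = - t i * s + e i"

text \<open>
  Upward jumps at the breakpoints are admitted, since the value function has them beyond the capacity.
  Where no jump occurs adjacent pieces are called joined; convexity holds up to the first breakpoint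
  where they may fail to be.
\<close>

locale pieces =
  fixes r :: real and t e :: "nat \<Rightarrow> real" and f :: "real \<Rightarrow> real"
  assumes r_pos: "r > 0"
    and slopes: "t (Suc i) \<le> t i"
    and jump: "affine_piece t e i (real (Suc i) * r) \<le> affine_piece t e (Suc i) (real (Suc i) * r)"
    and piece: "s \<in> {real i * r..<(real i + 1) * r} \<Longrightarrow> f s = affine_piece t e i s"
begin

lemma in_some_piece:
  assumes "s \<ge> 0"
  obtains i where "s \<in> {real i * r..<(real i + 1) * r}"
proof
  define i where "i = nat \<lfloor>s / r\<rfloor>"
  have "real i = of_int \<lfloor>s / r\<rfloor>"
    using assms r_pos by (simp add: i_def)
  then have "real i \<le> s / r" "s / r < real i + 1"
    by linarith+
  then show "s \<in> {real i * r..<(real i + 1) * r}"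
    using r_pos by (simp add: field_simps)
qed

text \<open>
  At its left end a piece starts at or above its predecessor and is at least as steep, so it stays above
  it; upward jumps only help.
\<close>

lemma later_piece_above:
  assumes "i \<le> j" "s \<ge> real j * r"
  shows "affine_piece t e i s \<le> affine_piece t e j s"
  using assms
proof (induction j rule: dec_induct)
  case base
  then show ?case by simp
next
  case (step j)
  have "(t j - t (Suc j)) * (s - real (Suc j) * r) \<ge> 0"
    using slopes step.prems by (intro mult_nonneg_nonneg) auto
  with jump[of j] have "affine_piece t e j s \<le> affine_piece t e (Suc j) s"
    by (simp add: affine_piece_def algebra_simps)
  moreover have "s \<ge> real j * r"
    using step.prems r_pos by (simp add: algebra_simps)
  ultimately show ?case using step.IH by simp
qed

text \<open>
  Going left the same comparison needs equality at the breakpoints in between: an upward jump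
  places the extension of the later piece above the earlier one next to the breakpoint.
\<close>

lemma earlier_piece_above:
  assumes "j \<le> i" "s \<le> (real j + 1) * r"
    and joined: "\<And>l. j \<le> l \<Longrightarrow> l < i \<Longrightarrow>
      affine_piece t e l (real (Suc l) * r) = affine_piece t e (Suc l) (real (Suc l) * r)"
  shows "affine_piece t e i s \<le> affine_piece t e j s"
  using assms
proof (induction i rule: dec_induct)
  case base
  then show ?case by simp
next
  case (step i)
  have "real j * r \<le> real i * r"
    using step.hyps r_pos by simp
  then have "(t i - t (Suc i)) * (real (Suc i) * r - s) \<ge> 0"
    using slopes step.prems by (intro mult_nonneg_nonneg) (auto simp: algebra_simps)
  with step.prems(2)[of i] step.hyps have "affine_piece t e (Suc i) s \<le> affine_piece t e i s"
    by (simp add: affine_piece_def algebra_simps)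
  then show ?case using step.IH step.prems by fastforce
qed

lemma piece_below_right:
  assumes "s \<ge> real i * r"
  shows "affine_piece t e i s \<le> f s"
proof -
  have "s \<ge> 0" using assms r_pos by (smt (verit) mult_nonneg_nonneg of_nat_0_le_iff)
  then obtain j where j: "s \<in> {real j * r..<(real j + 1) * r}" by (rule in_some_piece)
  then have "real i * r < (real j + 1) * r" using assms by simp
  then have "i \<le> j" using r_pos by (simp add: mult_less_cancel_right)
  then show ?thesis using later_piece_above[of i j s] j piece[OF j] by simp
qed

definition joined_upto :: "nat \<Rightarrow> bool" where
  "joined_upto m \<longleftrightarrow> (\<forall>i<m. affine_piece t e i (real (Suc i) * r) = affine_piece t e (Suc i) (real (Suc i) * r))"

lemma piece_below:
  assumes "joined_upto m" "i \<le> m" "s \<ge> 0"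
  shows "affine_piece t e i s \<le> f s"
proof (cases "s \<ge> real i * r")
  case True
  then show ?thesis by (rule piece_below_right)
next
  case False
  obtain j where j: "s \<in> {real j * r..<(real j + 1) * r}" using assms(3) by (rule in_some_piece)
  then have "real j * r < real i * r" using False by simp
  then have "j < i" using r_pos by simp
  then show ?thesis
    using earlier_piece_above[of j i s] j piece[OF j] assms(1,2) by (simp add: joined_upto_def)
qed

text \<open>
  Every point below \<open>(m + 1) * r\<close> has a supporting affine piece, which gives the convexity inequality
  there. The right end point may be included although \<open>f\<close> may jump up at it, because it is never a
  proper convex combination of two distinct points.
\<close>

lemma convex_upto:
  assumes "joined_upto m"
  shows "convex_on {0..(real m + 1) * r} f"
proof (rule convex_onI)
  fix u x y :: real
  assume u: "0 < u" "u < 1" and x: "x \<in> {0..(real m + 1) * r}" and y: "y \<in> {0..(real m + 1) * r}"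
  define z where "z = (1 - u) * x + u * y"
  have "f z \<le> (1 - u) * f x + u * f y"
  proof (cases "x = y")
    case True
    then show ?thesis by (simp add: z_def algebra_simps)
  next
    case False
    have "z < (real m + 1) * r"
    proof -
      have "(1 - u) * x \<le> (1 - u) * ((real m + 1) * r)" "u * y \<le> u * ((real m + 1) * r)"
        using u x y by (auto intro!: mult_left_mono)
      moreover have "(1 - u) * x < (1 - u) * ((real m + 1) * r) \<or> u * y < u * ((real m + 1) * r)"
      proof -
        have "x < (real m + 1) * r \<or> y < (real m + 1) * r" using False x y by auto
        then show ?thesis using u by (meson diff_gt_0_iff_gt mult_strict_left_mono)
      qed
      moreover have "(1 - u) * ((real m + 1) * r) + u * ((real m + 1) * r) = (real m + 1) * r"
        by (simp only: distrib_right[symmetric]) simp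
      ultimately show ?thesis unfolding z_def by linarith
    qed
    moreover have "z \<ge> 0"
      unfolding z_def using u x y by simp
    ultimately obtain i where i: "z \<in> {real i * r..<(real i + 1) * r}"
      using in_some_piece by metis
    then have "real i * r < (real m + 1) * r" using \<open>z < _\<close> by simp
    then have "i \<le> m" using r_pos by (simp add: mult_less_cancel_right)
    then have "affine_piece t e i x \<le> f x" "affine_piece t e i y \<le> f y"
      using piece_below[OF assms] x y by auto
    then have "(1 - u) * affine_piece t e i x + u * affine_piece t e i y \<le> (1 - u) * f x + u * f y"
      using u by (intro add_mono mult_left_mono) auto
    then show ?thesis
      using piece[OF i] by (simp add: affine_piece_def z_def algebra_simps)
  qed
  then show "f ((1 - u) *\<^sub>R x + u *\<^sub>R y) \<le> (1 - u) * f x + u * f y"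
    by (simp add: z_def)
qed simp

lemma convex_if_joined:
  assumes "\<And>m. joined_upto m"
  shows "convex_on {0..} f"
proof (rule convex_onI)
  fix u x y :: real
  assume u: "0 < u" "u < 1" and xy: "x \<in> {0..}" "y \<in> {0..}"
  obtain m where m: "max x y \<in> {real m * r..<(real m + 1) * r}"
  proof (rule in_some_piece)
    show "0 \<le> max x y" using xy by auto
  qed
  show "f ((1 - u) *\<^sub>R x + u *\<^sub>R y) \<le> (1 - u) * f x + u * f y"
    using convex_onD[OF convex_upto[OF assms, of m], of u x y] u xy m by auto
qed simp

text \<open>
  The next three lemmas locate a minimizer of \<open>l * x + f x\<close>, where \<open>x\<close> is the level after trading.
  The first one, which looks only to the right, holds beyond the joined range as well.
\<close>

lemma optimal_sell:
  assumes "t i \<le> l" "x \<in> {real i * r..<(real i + 1) * r}" "y \<ge> x"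
  shows "l * x + f x \<le> l * y + f y"
proof -
  have "affine_piece t e i y \<le> f y" using assms by (intro piece_below_right) auto
  moreover have "(l - t i) * (y - x) \<ge> 0" using assms by simp
  ultimately show ?thesis
    using piece[OF assms(2)] by (simp add: affine_piece_def algebra_simps)
qed

lemma optimal_buy:
  assumes "joined_upto m" "i \<le> m" "l \<le> t i" "x \<in> {real i * r..<(real i + 1) * r}" "0 \<le> y" "y \<le> x"
  shows "l * x + f x \<le> l * y + f y"
proof -
  have "affine_piece t e i y \<le> f y" using assms by (intro piece_below) auto
  moreover have "(t i - l) * (x - y) \<ge> 0" using assms by simp
  ultimately show ?thesis
    using piece[OF assms(4)] by (simp add: affine_piece_def algebra_simps)
qed

lemma optimal_breakpoint:
  assumes m: "joined_upto m" "Suc i \<le> m" and l: "t (Suc i) \<le> l" "l \<le> t i" and y: "y \<ge> 0"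
  defines "x \<equiv> real (Suc i) * r"
  shows "l * x + f x \<le> l * y + f y"
proof (cases "y \<ge> x")
  case True
  then show ?thesis
    using optimal_sell[of "Suc i" l x y] l r_pos by (simp add: x_def)
next
  case False
  have fx: "f x = affine_piece t e (Suc i) x"
    using piece[of x "Suc i"] r_pos by (simp add: x_def)
  also have "\<dots> = affine_piece t e i x"
    using m by (simp add: joined_upto_def x_def)
  finally have "f x = affine_piece t e i x" .
  moreover have "affine_piece t e i y \<le> f y" using piece_below[OF m(1)] m(2) y by simp
  moreover have "(t i - l) * (x - y) \<ge> 0" using l False by simp
  ultimately show ?thesis
    by (simp add: affine_piece_def algebra_simps)
qed

end

text \<open>
  The penalty itself has no jumps: a convex function on the half line is continuous at each breakpoint.
  Both facts come from the chord inequality for three points around the breakpoint.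
\<close>

lemma convex_piecewise_linear:
  fixes h :: "real \<Rightarrow> real"
  assumes "r > 0" and conv: "convex_on {0..} h"
    and piece: "\<And>i s. s \<in> {real i * r..<(real i + 1) * r} \<Longrightarrow> h s = a i * s + c i"
  shows "a i \<le> a (Suc i)"
    and "a i * (real (Suc i) * r) + c i = a (Suc i) * (real (Suc i) * r) + c (Suc i)"
proof -
  define b where "b = real (Suc i) * r"
  define L where "L = a i * b + c i"
  have b: "b - r \<ge> 0" using \<open>r > 0\<close> by (simp add: b_def algebra_simps)
  have left: "h (b - x) = L - a i * x" if "0 < x" "x \<le> r" for x
    using piece[of "b - x" i] that by (simp add: b_def L_def algebra_simps)
  have right: "h (b + x) = h b + a (Suc i) * x" if "0 \<le> x" "x < r" for x
    using piece[of "b + x" "Suc i"] piece[of b "Suc i"] that by (simp add: b_def algebra_simps)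
  have chord: "h b * (x + y) \<le> h (b - x) * y + h (b + y) * x"
    if "0 < x" "x \<le> r" "0 < y" for x y
  proof -
    define u where "u = x / (x + y)"
    have "(1 - u) *\<^sub>R (b - x) + u *\<^sub>R (b + y) = b - x + u * (x + y)"
      by (simp add: algebra_simps)
    also have "\<dots> = b" using that by (simp add: u_def)
    finally have "(1 - u) *\<^sub>R (b - x) + u *\<^sub>R (b + y) = b" .
    moreover have "h ((1 - u) *\<^sub>R (b - x) + u *\<^sub>R (b + y)) \<le> (1 - u) * h (b - x) + u * h (b + y)"
      using that b by (intro convex_onD[OF conv]) (auto simp: u_def)
    ultimately have "h b * (x + y) \<le> ((1 - u) * h (b - x) + u * h (b + y)) * (x + y)"
      using that by (intro mult_right_mono) auto
    also have "\<dots> = h (b - x) * ((x + y) - u * (x + y)) + h (b + y) * (u * (x + y))"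
      by (simp add: algebra_simps)
    also have "u * (x + y) = x" using that by (simp add: u_def)
    finally show ?thesis by simp
  qed
  have "h b \<le> L"
  proof (rule field_le_epsilon)
    fix \<epsilon> :: real assume "\<epsilon> > 0"
    (* The chord from b - x to b + x bounds h b by L + (a (Suc i) - a i) * x only;
       this x makes the excess at most \<epsilon>. *)
    define x where "x = min (r / 2) (\<epsilon> / (\<bar>a (Suc i) - a i\<bar> + 1))"
    have x: "0 < x" "x \<le> r" "x < r" using \<open>\<epsilon> > 0\<close> \<open>r > 0\<close> by (auto simp: x_def)
    have "h b * (x + x) \<le> (L - a i * x) * x + (h b + a (Suc i) * x) * x"
      using chord[of x x] left[of x] right[of x] x by simp
    then have "h b * x \<le> (L + (a (Suc i) - a i) * x) * x"
      by (simp add: algebra_simps)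
    then have "h b \<le> L + (a (Suc i) - a i) * x" using x by simp
    also have "(a (Suc i) - a i) * x \<le> \<bar>a (Suc i) - a i\<bar> * x"
      using x by (intro mult_right_mono) auto
    also have "\<dots> \<le> (\<bar>a (Suc i) - a i\<bar> + 1) * (\<epsilon> / (\<bar>a (Suc i) - a i\<bar> + 1))"
      using x \<open>\<epsilon> > 0\<close> by (intro mult_mono) (auto simp: x_def)
    also have "\<dots> = \<epsilon>" by simp
    finally show "h b \<le> L + \<epsilon>" by simp
  qed
  moreover have "L \<le> h b"
  proof -
    have "h ((1 - 1/2) *\<^sub>R (b - r) + (1/2) *\<^sub>R b) \<le> (1 - 1/2) * h (b - r) + (1/2) * h b"
      using b \<open>r > 0\<close> by (intro convex_onD[OF conv]) auto
    also have "(1 - 1/2) *\<^sub>R (b - r) + (1/2) *\<^sub>R b = b - r / 2"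
      unfolding real_scaleR_def by (simp add: field_simps)
    finally have "h (b - r / 2) \<le> (1 - 1/2) * h (b - r) + (1/2) * h b" .
    then show ?thesis using left[of r] left[of "r/2"] \<open>r > 0\<close> by (simp add: field_simps)
  qed
  ultimately have hb: "h b = L" by (rule antisym)
  have "L * (r / 2 + r / 2) \<le> (L - a i * (r / 2)) * (r / 2) + (L + a (Suc i) * (r / 2)) * (r / 2)"
    using chord[of "r/2" "r/2"] left[of "r/2"] right[of "r/2"] \<open>r > 0\<close> unfolding hb by simp
  then have "a i * (r / 2 * (r / 2)) \<le> a (Suc i) * (r / 2 * (r / 2))"
    by (simp only: left_diff_distrib distrib_right distrib_left mult.assoc)
  then show "a i \<le> a (Suc i)"
    using \<open>r > 0\<close> by simp
  have "h b = a (Suc i) * b + c (Suc i)"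
    using piece[of b "Suc i"] \<open>r > 0\<close> by (simp add: b_def)
  then show "a i * (real (Suc i) * r) + c i = a (Suc i) * (real (Suc i) * r) + c (Suc i)"
    using hb unfolding L_def b_def by simp
qed

section \<open>The stage recursion\<close>

definition line :: "storage \<Rightarrow> nat \<Rightarrow> nat \<Rightarrow> real \<Rightarrow> real" where
  "line M k = affine_piece (thr M k) (intercept M k)"

text \<open>
  The minimum over the controls at level \<open>s\<close> in segment \<open>i\<close>, written with the affine pieces of the next
  stage. Using the pieces rather than \<open>V\<close> makes it meaningful for every \<open>s\<close>, so that two neighbouring
  segments can be compared at their common breakpoint.
\<close>

definition trade_cost :: "storage \<Rightarrow> nat \<Rightarrow> nat \<Rightarrow> real \<Rightarrow> real \<Rightarrow> real" where
  "trade_cost M k i s l =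
    (if thr M (k + 1) (i - 1) < l then
       (if i = 0 then - l * s + line M (k + 1) 0 0 else - l * rate M + line M (k + 1) (i - 1) (s - rate M))
     else if i \<ge> 1 \<and> thr M (k + 1) i < l then
       l * (real i * rate M - s) + line M (k + 1) i (real i * rate M)
     else if thr M (k + 1) (i + 1) < l then
       l * ((real i + 1) * rate M - s) + line M (k + 1) (i + 1) ((real i + 1) * rate M)
     else l * rate M + line M (k + 1) (i + 1) (s + rate M))"

definition clamped_price :: "storage \<Rightarrow> nat \<Rightarrow> nat \<Rightarrow> real \<Rightarrow> real" where
  "clamped_price M k i l =
    (if i = 0 then max l (thr M (k + 1) 1)
     else min (thr M (k + 1) (i - 1)) (max l (thr M (k + 1) (i + 1))))"

text \<open>
  The slope of the minimum in \<open>s\<close> is, up to sign, the price clamped between the two neighbouring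
  thresholds: the price decides when the target is a breakpoint or zero, the threshold when the whole rate is
  used.
\<close>

lemma thr_expectation:
  assumes "k < horizon M" and supp: "set_pmf (price M k) \<subseteq> {lo..price_max M k}"
    and anti: "\<And>i. thr M (k + 1) (Suc i) \<le> thr M (k + 1) i"
  shows "has_bochner_integral (measure_pmf (price M k)) (clamped_price M k i) (thr M k i + slope M k i)"
proof (cases i)
  case 0
  have "has_bochner_integral (measure_pmf (price M k))
     (\<lambda>l. thr M (k + 1) 1 + 1 * max 0 (l - thr M (k + 1) 1))
     (thr M (k + 1) 1 + Phi (price M k) 1 {thr M (k + 1) 1<..price_max M k})"
    by (intro has_expectation_intros Phi_tail_expectation[OF supp])
  then show ?thesis
    by (rule has_expectation_cong) (use assms(1) in \<open>auto simp: 0 clamped_price_def thr.simps[of M k 0]\<close>)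
next
  case (Suc j)
  define t where "t = thr M (k + 1)"
  have t: "t (j + 2) \<le> t (j + 1)" "t (j + 1) \<le> t j"
    using anti[of j] anti[of "j + 1"] by (auto simp: t_def)
  have "has_bochner_integral (measure_pmf (price M k))
     (\<lambda>l. t j + 1 * ((l - t (j + 2)) * indicator {t (j + 2)<..t j} l) + (t (j + 2) - t j) * indicator {..t j} l)
     (t j + Phi (price M k) 1 {t (j + 2)<..t j} + (t (j + 2) - t j) * cdf (price M k) (t j))"
    by (intro has_expectation_intros Phi_Ioc_expectation[OF supp] cdf_expectation)
  then show ?thesis
  proof (rule has_expectation_cong)
    fix l :: real
    show "t j + 1 * ((l - t (j + 2)) * indicator {t (j + 2)<..t j} l) + (t (j + 2) - t j) * indicator {..t j} l
      = clamped_price M k i l"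
      using t unfolding clamped_price_def Suc t_def[symmetric]
      by (cases "l \<le> t j"; cases "l \<le> t (j + 2)") auto
  qed (use assms(1) in \<open>simp add: Suc t_def thr.simps[of M k "Suc j"]\<close>)
qed

text \<open>
  The recursions for thresholds and intercepts are the expectation of \<open>trade_cost\<close>, for every real \<open>s\<close>.
  For a fixed price each term of the recursions contributes a truncated difference or an indicator, and
  in each of the cases of \<open>trade_cost\<close> these add up to the affine function of that case.
\<close>

lemma line_expectation:
  assumes "k < horizon M" and supp: "set_pmf (price M k) \<subseteq> {price_min M k..price_max M k}"
    and anti: "\<And>i. thr M (k + 1) (Suc i) \<le> thr M (k + 1) i"
  shows "has_bochner_integral (measure_pmf (price M k)) (trade_cost M k i s)
    (line M k i s - (slope M k i * s + icpt M k i))"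
proof -
  define t where "t = thr M (k + 1)"
  define e where "e = intercept M (k + 1)"
  let ?p = "price M k" and ?r = "rate M" and ?lo = "price_min M k" and ?hi = "price_max M k"
  have mean: "has_bochner_integral (measure_pmf ?p) (\<lambda>l. l) (mean_price M k)"
    unfolding mean_price_def using supp
    by (intro has_expectation[where B = "max \<bar>?lo\<bar> \<bar>?hi\<bar>"]) fastforce
  show ?thesis
  proof (cases i)
    case 0
    have t: "t 1 \<le> t 0"
      using anti[of 0] by (simp add: t_def)
    have "has_bochner_integral (measure_pmf ?p)
       (\<lambda>l. e 0 - s * (t 1 + 1 * max 0 (l - t 1)) + ?r * ((l - ?lo) * indicator {..t 0} l)
         + (?r * ?lo + e 1 - e 0 - ?r * t 1) * indicator {..t 0} l)
       (e 0 - s * (t 1 + Phi ?p 1 {t 1<..?hi}) + Phi ?p ?r {?lo..t 0}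
         + (?r * ?lo + e 1 - e 0 - ?r * t 1) * cdf ?p (t 0))"
      by (intro has_expectation_intros Phi_tail_expectation[OF supp] Phi_initial_expectation[OF supp]
          cdf_expectation)
    then show ?thesis
    proof (rule has_expectation_cong)
      fix l :: real
      show "e 0 - s * (t 1 + 1 * max 0 (l - t 1)) + ?r * ((l - ?lo) * indicator {..t 0} l)
         + (?r * ?lo + e 1 - e 0 - ?r * t 1) * indicator {..t 0} l = trade_cost M k i s l"
        using t unfolding trade_cost_def 0 line_def affine_piece_def t_def[symmetric] e_def[symmetric]
        by (cases "l \<le> t 0"; cases "l \<le> t 1") (auto simp: algebra_simps)
    qed (use assms(1) in \<open>simp add: 0 line_def affine_piece_def t_def e_def
        thr.simps[of M k 0] intercept.simps[of M k 0] algebra_simps\<close>)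
  next
    case (Suc j)
    have t: "t (j + 2) \<le> t (j + 1)" "t (j + 1) \<le> t j"
      using anti[of j] anti[of "j + 1"] by (auto simp: t_def)
    have "has_bochner_integral (measure_pmf ?p)
      (\<lambda>l. ?r * l
        - s * (t j + 1 * ((l - t (j + 2)) * indicator {t (j + 2)<..t j} l) + (t (j + 2) - t j) * indicator {..t j} l)
        + ((e j - ?r * t (j + 2) + (e (j + 1) - e j) * indicator {..t j} l
             + (e (j + 2) - e (j + 1)) * indicator {..t (j + 1)} l)
          + ((real i + 1) * (?r * ((l - t (j + 2)) * indicator {t (j + 2)<..t (j + 1)} l))
             + real i * (?r * ((l - t (j + 1)) * indicator {t (j + 1)<..t j} l))
             - ?r * max 0 (l - t j) - ?r * max 0 (l - t (j + 2)))))
      (?r * mean_price M k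
        - s * (t j + Phi ?p 1 {t (j + 2)<..t j} + (t (j + 2) - t j) * cdf ?p (t j))
        + ((e j - ?r * t (j + 2) + (e (j + 1) - e j) * cdf ?p (t j)
             + (e (j + 2) - e (j + 1)) * cdf ?p (t (j + 1)))
          + ((real i + 1) * Phi ?p ?r {t (j + 2)<..t (j + 1)}
             + real i * Phi ?p ?r {t (j + 1)<..t j}
             - Phi ?p ?r {t j<..?hi} - Phi ?p ?r {t (j + 2)<..?hi})))"
      by (intro has_expectation_intros Phi_tail_expectation[OF supp] Phi_Ioc_expectation[OF supp]
          cdf_expectation mean)
    then show ?thesis
    proof (rule has_expectation_cong)
      fix l :: real
      have ri: "real i = real j + 1" by (simp add: Suc)
      consider "t j < l" | "t (j + 1) < l" "l \<le> t j" | "t (j + 2) < l" "l \<le> t (j + 1)" | "l \<le> t (j + 2)"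
        by linarith
      then show "?r * l
        - s * (t j + 1 * ((l - t (j + 2)) * indicator {t (j + 2)<..t j} l) + (t (j + 2) - t j) * indicator {..t j} l)
        + ((e j - ?r * t (j + 2) + (e (j + 1) - e j) * indicator {..t j} l
             + (e (j + 2) - e (j + 1)) * indicator {..t (j + 1)} l)
          + ((real i + 1) * (?r * ((l - t (j + 2)) * indicator {t (j + 2)<..t (j + 1)} l))
             + real i * (?r * ((l - t (j + 1)) * indicator {t (j + 1)<..t j} l))
             - ?r * max 0 (l - t j) - ?r * max 0 (l - t (j + 2))))
        = trade_cost M k i s l"
        using t unfolding trade_cost_def ri Suc line_def affine_piece_def t_def[symmetric] e_def[symmetric]
        by cases (auto simp: algebra_simps)
    next
      have thr_eq: "thr M k i = t j - slope M k i + Phi ?p 1 {t (j + 2)<..t j} + (t (j + 2) - t j) * cdf ?p (t j)"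
        using assms(1) by (simp add: thr.simps[of M k "Suc j"] Suc t_def)
      have intercept_eq: "intercept M k i = icpt M k i + ?r * mean_price M k
        + (e j - ?r * t (j + 2) + (e (j + 1) - e j) * cdf ?p (t j)
             + (e (j + 2) - e (j + 1)) * cdf ?p (t (j + 1)))
        + ((real i + 1) * Phi ?p ?r {t (j + 2)<..t (j + 1)}
             + real i * Phi ?p ?r {t (j + 1)<..t j}
             - Phi ?p ?r {t j<..?hi} - Phi ?p ?r {t (j + 2)<..?hi})"
        using assms(1) by (simp add: intercept.simps[of M k "Suc j"] Suc t_def e_def Let_def)
      show "?r * mean_price M k
        - s * (t j + Phi ?p 1 {t (j + 2)<..t j} + (t (j + 2) - t j) * cdf ?p (t j))
        + ((e j - ?r * t (j + 2) + (e (j + 1) - e j) * cdf ?p (t j)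
             + (e (j + 2) - e (j + 1)) * cdf ?p (t (j + 1)))
          + ((real i + 1) * Phi ?p ?r {t (j + 2)<..t (j + 1)}
             + real i * Phi ?p ?r {t (j + 1)<..t j}
             - Phi ?p ?r {t j<..?hi} - Phi ?p ?r {t (j + 2)<..?hi}))
        = line M k i s - (slope M k i * s + icpt M k i)"
        unfolding line_def affine_piece_def thr_eq intercept_eq by (simp add: algebra_simps)
    qed
  qed
qed

section \<open>Shape of the value function and optimality of the threshold control\<close>

locale storage_problem =
  fixes M :: storage
  assumes rate_pos: "rate M > 0"
    and blocks_pos: "blocks M \<ge> 1"
    and price_min_nonneg: "\<And>k. k \<le> horizon M \<Longrightarrow> 0 \<le> price_min M k"
    and price_support: "\<And>k. k \<le> horizon M \<Longrightarrow> set_pmf (price M k) \<subseteq> {price_min M k..price_max M k}"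
    and salvage_range: "salvage M \<in> {price_min M (horizon M)..price_max M (horizon M)}"
    and penalty_nonneg: "\<And>k s. k \<le> horizon M \<Longrightarrow> s \<ge> 0 \<Longrightarrow> penalty M k s \<ge> 0"
    and penalty_mono: "\<And>k. k \<le> horizon M \<Longrightarrow> mono_on {0..} (penalty M k)"
    and penalty_convex: "\<And>k. k \<le> horizon M \<Longrightarrow> convex_on {0..} (penalty M k)"
    and penalty_piece: "\<And>k i s. k \<le> horizon M \<Longrightarrow> s \<in> segment M i \<Longrightarrow>
           penalty M k s = slope M k i * s + icpt M k i"
    and steep_beyond_capacity: "\<And>k i. k \<le> horizon M \<Longrightarrow> i \<ge> blocks M \<Longrightarrow> slope M k i > price_max M k"
begin

lemma slope_mono: "k \<le> horizon M \<Longrightarrow> slope M k i \<le> slope M k (Suc i)"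
  using convex_piecewise_linear(1)[OF rate_pos penalty_convex[of k] penalty_piece[of k, unfolded segment_def]]
  by simp

lemma penalty_joined:
  "k \<le> horizon M \<Longrightarrow> slope M k i * (real (Suc i) * rate M) + icpt M k i
    = slope M k (Suc i) * (real (Suc i) * rate M) + icpt M k (Suc i)"
  using convex_piecewise_linear(2)[OF rate_pos penalty_convex[of k] penalty_piece[of k, unfolded segment_def]]
  by simp

lemma price_nonneg: "k \<le> horizon M \<Longrightarrow> l \<in> set_pmf (price M k) \<Longrightarrow> 0 \<le> l"
  using price_support[of k] price_min_nonneg[of k] by force

lemma price_max_nonneg: "k \<le> horizon M \<Longrightarrow> 0 \<le> price_max M k"
  using price_support[of k] price_min_nonneg[of k] set_pmf_not_empty[of "price M k"] by force

lemma segment_of_eq: "s \<in> segment M i \<Longrightarrow> segment_of M s = i"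
proof -
  assume "s \<in> segment M i"
  then have "\<lfloor>s / rate M\<rfloor> = int i"
    using rate_pos by (intro floor_unique) (auto simp: segment_def field_simps)
  then show ?thesis by (simp add: segment_of_def)
qed

lemma in_segment_of:
  assumes "s \<ge> 0"
  shows "s \<in> segment M (segment_of M s)"
proof -
  have "real (segment_of M s) = of_int \<lfloor>s / rate M\<rfloor>"
    using assms rate_pos by (simp add: segment_of_def)
  then have "real (segment_of M s) \<le> s / rate M" "s / rate M < real (segment_of M s) + 1"
    by linarith+
  then show ?thesis
    using rate_pos by (simp add: segment_def field_simps)
qed

definition flat_tail :: bool where
  "flat_tail \<longleftrightarrow> (\<forall>i\<ge>blocks M. slope M (horizon M) i = slope M (horizon M) (blocks M))"

text \<open>
  The induction invariant. The pieces meet at the breakpoint \<open>Suc i\<close> for \<open>i < blocks M\<close>, that is, up to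
  and including the capacity; under \<open>flat_tail\<close> the terminal value has no jumps, and then no stage has any.
\<close>

definition well_shaped :: "nat \<Rightarrow> bool" where
  "well_shaped k \<longleftrightarrow>
    (\<forall>i. thr M k (Suc i) \<le> thr M k i) \<and>
    (\<forall>i\<ge>blocks M. thr M k i < 0) \<and>
    (\<forall>i. line M k i (real (Suc i) * rate M) \<le> line M k (Suc i) (real (Suc i) * rate M)) \<and>
    (\<forall>i. i < blocks M \<or> flat_tail \<longrightarrow>
       line M k i (real (Suc i) * rate M) = line M k (Suc i) (real (Suc i) * rate M)) \<and>
    (\<forall>i. \<forall>s\<in>segment M i. V M k s = line M k i s)"

lemma well_shapedD:
  assumes "well_shaped k"
  shows "thr M k (Suc i) \<le> thr M k i"
    and "i \<ge> blocks M \<Longrightarrow> thr M k i < 0"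
    and "line M k i (real (Suc i) * rate M) \<le> line M k (Suc i) (real (Suc i) * rate M)"
    and "i < blocks M \<or> flat_tail \<Longrightarrow>
      line M k i (real (Suc i) * rate M) = line M k (Suc i) (real (Suc i) * rate M)"
    and "s \<in> segment M i \<Longrightarrow> V M k s = line M k i s"
  using assms unfolding well_shaped_def by blast+

lemma well_shaped_pieces:
  assumes "well_shaped k"
  shows "pieces (rate M) (thr M k) (intercept M k) (V M k)"
  using well_shapedD[OF assms] rate_pos by unfold_locales (auto simp: line_def segment_def)

lemma joined_upto_blocks:
  assumes "well_shaped k"
  shows "m \<le> blocks M \<or> flat_tail \<Longrightarrow> pieces.joined_upto (rate M) (thr M k) (intercept M k) m"
  using well_shapedD(4)[OF assms] pieces.joined_upto_def[OF well_shaped_pieces[OF assms]]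
  by (auto simp: line_def)

text \<open>
  Beyond the capacity the terminal pieces are lines with slopes \<open>slope M (horizon M) i\<close> through one common
  point at the capacity. They fan out to the right of it, which produces the upward jumps.
\<close>

lemma well_shaped_horizon: "well_shaped (horizon M)"
  unfolding well_shaped_def
proof (intro conjI allI impI ballI)
  let ?N = "horizon M" and ?n = "blocks M"
  have tN: "thr M ?N i = (if i < ?n then salvage M else - slope M ?N i)" for i
    by (simp add: thr.simps[of M ?N])
  have eN: "intercept M ?N i = (if i < ?n then 0 else capacity M * (thr M ?N i - salvage M))" for i
    by (simp add: intercept.simps[of M ?N])
  have salvage: "0 \<le> salvage M"
    using salvage_range price_min_nonneg[of ?N] by auto
  have steep: "slope M ?N i > 0" if "i \<ge> ?n" for i
    using steep_beyond_capacity[of ?N i] price_max_nonneg[of ?N] that by simp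
  have lineN: "line M ?N i s = (if i < ?n then - salvage M * s
      else slope M ?N i * (s - capacity M) - capacity M * salvage M)" for i s
    by (simp add: line_def affine_piece_def tN eN algebra_simps)
  fix i
  show "thr M ?N (Suc i) \<le> thr M ?N i"
    using salvage steep[of "Suc i"] slope_mono[of ?N i] by (auto simp: tN)
  show "thr M ?N i < 0" if "?n \<le> i"
    using steep[of i] that by (simp add: tN)
  have at_capacity: "Suc i = ?n \<Longrightarrow> real (Suc i) * rate M = capacity M"
    by (simp add: capacity_def)
  have beyond: "?n \<le> i \<Longrightarrow> capacity M \<le> real (Suc i) * rate M"
    using rate_pos by (simp add: capacity_def)
  show "line M ?N i (real (Suc i) * rate M) \<le> line M ?N (Suc i) (real (Suc i) * rate M)"
  proof (cases "?n \<le> i")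
    case True
    then show ?thesis
      using mult_right_mono[OF slope_mono[of ?N i], of "real (Suc i) * rate M - capacity M"] beyond
      by (simp add: lineN)
  next
    case False
    show ?thesis
    proof (cases "Suc i = ?n")
      case True
      then show ?thesis unfolding at_capacity[OF True] by (simp add: lineN)
    next
      case other: False
      then have "Suc i < ?n" using False by simp
      then show ?thesis by (simp add: lineN)
    qed
  qed
  show "line M ?N i (real (Suc i) * rate M) = line M ?N (Suc i) (real (Suc i) * rate M)"
    if "i < ?n \<or> flat_tail"
  proof (cases "?n \<le> i")
    case True
    then have "slope M ?N i = slope M ?N ?n" "slope M ?N (Suc i) = slope M ?N ?n"
      using that unfolding flat_tail_def by (meson le_SucI not_le)+
    then show ?thesis using True by (simp add: lineN)
  next
    case False
    show ?thesis
    proof (cases "Suc i = ?n")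
      case True
      then show ?thesis unfolding at_capacity[OF True] by (simp add: lineN)
    next
      case other: False
      then have "Suc i < ?n" using False by simp
      then show ?thesis by (simp add: lineN)
    qed
  qed
  fix s assume s: "s \<in> segment M i"
  have V: "V M ?N s = terminal_value M s" by (simp add: V.simps)
  show "V M ?N s = line M ?N i s"
  proof (cases "i < ?n")
    case True
    then have "(real i + 1) * rate M \<le> capacity M"
      using rate_pos by (simp add: capacity_def)
    then show ?thesis
      using True s by (simp add: V terminal_value_def lineN segment_def)
  next
    case False
    then have "capacity M \<le> real i * rate M"
      using rate_pos by (simp add: capacity_def)
    then have "s = capacity M \<or> s > capacity M"
      using s by (auto simp: segment_def)
    then show ?thesis
    proof
      assume "s = capacity M"
      then show ?thesis using False V by (simp add: terminal_value_def lineN)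
    next
      assume "s > capacity M"
      then show ?thesis
        by (simp add: V terminal_value_def segment_of_eq[OF s] line_def affine_piece_def)
    qed
  qed
qed

lemma thresholds_decreasing_step:
  assumes k: "k < horizon M" and next_shaped: "well_shaped (k + 1)"
  shows "thr M k (Suc i) \<le> thr M k i"
proof -
  note anti = well_shapedD(1)[OF next_shaped]
  note ex = thr_expectation[OF k price_support anti]
  have "thr M k (Suc i) + slope M k (Suc i) \<le> thr M k i + slope M k i"
  proof (rule has_expectation_mono[OF ex ex])
    fix l
    show "clamped_price M k (Suc i) l \<le> clamped_price M k i l"
      using anti[of i] anti[of "Suc i"] anti[of "i - 1"]
      by (cases i) (auto simp: clamped_price_def)
  qed (use k in auto)
  then show ?thesis using slope_mono[of k i] k by simp
qed

text \<open>
  This is where the steep penalty beyond the capacity is used: the clamped price is at most the maximal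
  price, since the threshold of the next segment is negative.
\<close>

lemma thresholds_negative_step:
  assumes k: "k < horizon M" and next_shaped: "well_shaped (k + 1)" and i: "i \<ge> blocks M"
  shows "thr M k i < 0"
proof -
  have "thr M k i + slope M k i \<le> price_max M k"
  proof (rule has_expectation_mono[OF thr_expectation[OF k price_support well_shapedD(1)[OF next_shaped]]
        has_expectation_const])
    fix l assume l: "l \<in> set_pmf (price M k)"
    have "thr M (k + 1) (i + 1) < 0" using well_shapedD(2)[OF next_shaped, of "i + 1"] i by simp
    then show "clamped_price M k i l \<le> price_max M k"
      using i blocks_pos l price_support[of k] price_max_nonneg[of k] k
      by (auto simp: clamped_price_def min_le_iff_disj)
  qed (use k in auto)
  then show ?thesis using steep_beyond_capacity[of k i] i k by simp
qed

text \<open>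
  Seen from the two adjacent segments, a breakpoint has the same optimal target level, which itself is
  a breakpoint (or zero); the two formulas can differ only in which piece is evaluated at it. When
  selling, the target is one breakpoint to the left; when buying, it lies within the capacity
  because the price is non-negative. So a jump at a breakpoint is passed on to the next one only.
\<close>

lemma trade_cost_at_breakpoint:
  assumes next_shaped: "well_shaped (k + 1)" and l: "0 \<le> l"
  shows "trade_cost M k i (real (Suc i) * rate M) l \<le> trade_cost M k (Suc i) (real (Suc i) * rate M) l"
    and "i < blocks M \<or> flat_tail \<Longrightarrow>
      trade_cost M k i (real (Suc i) * rate M) l = trade_cost M k (Suc i) (real (Suc i) * rate M) l"
proof -
  let ?t = "thr M (k + 1)" and ?L = "line M (k + 1)" and ?r = "rate M"
  note anti = well_shapedD(1)[OF next_shaped]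
  define A where "A = trade_cost M k i (real (Suc i) * rate M) l"
  define B where "B = trade_cost M k (Suc i) (real (Suc i) * rate M) l"
  have arith: "real (Suc i) * ?r - ?r = real i * ?r" "real (Suc i) * ?r + ?r = real (Suc (Suc i)) * ?r"
    by (simp_all add: algebra_simps)
  have "A \<le> B \<and> (i < blocks M \<or> flat_tail \<longrightarrow> A = B)"
  proof -
    consider (low) "?t i < l" "i = 0"
      | (sell) j where "i = Suc j" "?t j < l"
      | (mid) j where "i = Suc j" "?t i < l" "l \<le> ?t j"
      | (stay) "?t (Suc i) < l" "l \<le> ?t i"
      | (buy) "l \<le> ?t (Suc i)"
      by (cases i) (auto, force+)
    then show ?thesis
    proof cases
      case low
      then show ?thesis by (simp add: A_def B_def trade_cost_def)
    next
      case (sell j)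
      then have "?t i < l" using anti[of j] by simp
      then have "B = - l * ?r + ?L i (real i * ?r)"
        using arith by (simp add: B_def trade_cost_def)
      moreover have "A = - l * ?r + ?L j (real i * ?r)"
        using sell arith by (simp add: A_def trade_cost_def)
      ultimately show ?thesis
        using well_shapedD(3,4)[OF next_shaped, of j] sell(1) by auto
    next
      case (mid j)
      then have "B = - l * ?r + ?L i (real i * ?r)"
        using arith by (simp add: B_def trade_cost_def)
      moreover have "A = l * (real i * ?r - real (Suc i) * ?r) + ?L i (real i * ?r)"
        using mid by (simp add: A_def trade_cost_def)
      ultimately show ?thesis by (simp add: algebra_simps)
    next
      case stay
      then have "B = ?L (Suc i) (real (Suc i) * ?r)"
        by (simp add: B_def trade_cost_def)
      moreover have "l \<le> ?t (i - 1)" using stay anti[of "i - 1"] by (cases i) auto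
      then have "A = ?L (Suc i) (real (Suc i) * ?r)"
        using stay by (auto simp: A_def trade_cost_def add.commute)
      ultimately show ?thesis by simp
    next
      case buy
      have le: "l \<le> ?t i" "l \<le> ?t (i - 1)"
        using buy anti[of i] anti[of "i - 1"] by (cases i; simp)+
      have "B = l * ?r + ?L (Suc (Suc i)) (real (Suc (Suc i)) * ?r)"
      proof (cases "?t (Suc (Suc i)) < l")
        case True
        then have "B = l * ((real (Suc i) + 1) * ?r - real (Suc i) * ?r)
            + ?L (Suc (Suc i)) ((real (Suc i) + 1) * ?r)"
          using buy le by (simp add: B_def trade_cost_def)
        then show ?thesis by (simp add: algebra_simps)
      next
        case False
        then have "B = l * ?r + ?L (Suc (Suc i)) (real (Suc i) * ?r + ?r)"
          using buy le by (simp add: B_def trade_cost_def)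
        then show ?thesis by (simp only: arith)
      qed
      moreover have "A = l * ?r + ?L (Suc i) (real (Suc i) * ?r + ?r)"
        using buy le by (auto simp: A_def trade_cost_def)
      then have "A = l * ?r + ?L (Suc i) (real (Suc (Suc i)) * ?r)"
        by (simp only: arith)
      moreover have "Suc i < blocks M"
        using well_shapedD(2)[OF next_shaped, of "Suc i"] buy l by (cases "Suc i < blocks M") auto
      ultimately show ?thesis
        using well_shapedD(4)[OF next_shaped, of "Suc i"] by simp
    qed
  qed
  then show "A \<le> B" "i < blocks M \<or> flat_tail \<Longrightarrow> A = B" by auto
qed

lemma lines_meet_step:
  assumes k: "k < horizon M" and next_shaped: "well_shaped (k + 1)"
  shows "line M k i (real (Suc i) * rate M) \<le> line M k (Suc i) (real (Suc i) * rate M)"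
    and "i < blocks M \<or> flat_tail \<Longrightarrow>
      line M k i (real (Suc i) * rate M) = line M k (Suc i) (real (Suc i) * rate M)"
proof -
  note ex = line_expectation[OF k price_support well_shapedD(1)[OF next_shaped]]
  note sc = trade_cost_at_breakpoint[OF next_shaped price_nonneg]
  let ?b = "real (Suc i) * rate M"
  have "line M k i ?b - (slope M k i * ?b + icpt M k i)
      \<le> line M k (Suc i) ?b - (slope M k (Suc i) * ?b + icpt M k (Suc i))"
    using k by (intro has_expectation_mono[OF ex ex] sc(1)) auto
  then show le: "line M k i ?b \<le> line M k (Suc i) ?b"
    using penalty_joined[of k i] k by simp
  assume joined: "i < blocks M \<or> flat_tail"
  have "line M k (Suc i) ?b - (slope M k (Suc i) * ?b + icpt M k (Suc i))
      \<le> line M k i ?b - (slope M k i * ?b + icpt M k i)"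
    using k joined by (intro has_expectation_mono[OF ex ex] eq_refl[OF sc(2)[symmetric]]) auto
  then show "line M k i ?b = line M k (Suc i) ?b"
    using le penalty_joined[of k i] k by simp
qed

text \<open>
  The last claim is the reason why no capacity constraint is needed: the control buys only up to levels
  whose threshold is at least the price, hence non-negative, and these lie within the capacity.
\<close>

lemma threshold_control_optimal:
  assumes next_shaped: "well_shaped (k + 1)" and l: "0 \<le> l" and s: "s \<in> segment M i"
  defines "v \<equiv> threshold_control M k s l"
  shows "v \<in> controls M s"
    and "l * v + V M (k + 1) (s + v) = trade_cost M k i s l"
    and "u \<in> controls M s \<Longrightarrow> l * v + V M (k + 1) (s + v) \<le> l * u + V M (k + 1) (s + u)"
    and "s \<le> capacity M \<Longrightarrow> s + v \<le> capacity M"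
proof -
  let ?t = "thr M (k + 1)" and ?L = "line M (k + 1)" and ?r = "rate M"
  interpret pieces ?r ?t "intercept M (k + 1)" "V M (k + 1)"
    by (rule well_shaped_pieces[OF next_shaped])
  note anti = well_shapedD(1)[OF next_shaped]
  note Vline = well_shapedD(5)[OF next_shaped]
  have joined: "joined_upto (blocks M)"
    by (rule joined_upto_blocks[OF next_shaped]) simp
  (* A non-negative price is above all thresholds of segments beyond the capacity. *)
  have full: "l \<le> ?t j \<Longrightarrow> j < blocks M" for j
    using well_shapedD(2)[OF next_shaped, of j] l by (cases "j < blocks M") auto
  have s': "real i * ?r \<le> s" "s < (real i + 1) * ?r"
    using s by (auto simp: segment_def)
  then have s0: "0 \<le> s" using rate_pos by (smt (verit) mult_nonneg_nonneg of_nat_0_le_iff)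
  have ri: "0 \<le> real i * ?r" using rate_pos by simp
  have below_capacity: "real j * ?r \<le> capacity M" if "j \<le> blocks M" for j
    using that rate_pos by (simp add: capacity_def)
  define x where "x = s + v"
  have v: "v = (if ?t (i - 1) < l then max (- s) (- ?r)
     else if i \<ge> 1 \<and> ?t i < l \<and> l \<le> ?t (i - 1) then real i * ?r - s
     else if ?t (i + 1) < l \<and> l \<le> ?t i then (real i + 1) * ?r - s
     else ?r)"
    by (simp add: v_def threshold_control_def Let_def segment_of_eq[OF s])
  have "v \<in> controls M s \<and> l * v + V M (k + 1) x = trade_cost M k i s l
     \<and> (\<forall>y\<ge>0. s - ?r \<le> y \<longrightarrow> y \<le> s + ?r \<longrightarrow> l * x + V M (k + 1) x \<le> l * y + V M (k + 1) y)
     \<and> (s \<le> capacity M \<longrightarrow> x \<le> capacity M)"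
  proof -
    consider (low) "?t i < l" "i = 0"
      | (sell) j where "i = Suc j" "?t j < l"
      | (mid) j where "i = Suc j" "?t i < l" "l \<le> ?t j"
      | (stay) "?t (i + 1) < l" "l \<le> ?t i"
      | (buy) "l \<le> ?t (i + 1)"
      by (cases i) (auto, force+)
    then show ?thesis
    proof cases
      case low
      then have v0: "v = - s" using s' by (simp add: v)
      then have x0: "x = 0" by (simp add: x_def)
      have "l * x + V M (k + 1) x \<le> l * y + V M (k + 1) y" if "y \<ge> 0" for y
        using optimal_sell[of 0 l x y] low that rate_pos by (simp add: x0)
      moreover have "V M (k + 1) x = ?L 0 0"
        using Vline[of x 0] rate_pos by (simp add: x0 segment_def)
      ultimately show ?thesis
        using low s' s0 below_capacity[of 0] rate_pos
        by (auto simp: v0 x0 controls_def trade_cost_def)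
    next
      case (sell j)
      have "0 \<le> real j * ?r" using rate_pos by simp
      then have rs: "?r \<le> s" using s'(1) by (simp add: sell(1) distrib_right)
      then have v0: "v = - ?r" using sell by (simp add: v)
      have seg: "x \<in> segment M j"
        using s' sell(1) by (simp add: x_def v0 segment_def algebra_simps)
      have "l * x + V M (k + 1) x \<le> l * y + V M (k + 1) y" if "s - ?r \<le> y" for y
        using optimal_sell[of j l x y] sell that seg by (simp add: x_def v0 segment_def)
      moreover have "x \<ge> 0"
        using rs by (simp add: x_def v0)
      ultimately show ?thesis
        using sell Vline[OF seg] rate_pos
        by (auto simp: v0 x_def controls_def trade_cost_def)
    next
      case (mid j)
      then have v0: "v = real i * ?r - s" by (simp add: v)
      have x0: "x = real (Suc j) * ?r" by (simp add: x_def v0 mid(1))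
      have "l * x + V M (k + 1) x \<le> l * y + V M (k + 1) y" if "y \<ge> 0" for y
        using optimal_breakpoint[OF joined, of j l y] full[of j] mid that by (simp add: x0)
      moreover have "V M (k + 1) x = ?L i x"
        using Vline[of x i] rate_pos mid(1) by (simp add: x0 segment_def)
      moreover have "x \<le> capacity M"
        using below_capacity[of "Suc j"] full[of j] mid by (simp add: x0)
      moreover have "v \<in> controls M s"
        using s' ri rate_pos by (auto simp: v0 controls_def max_def algebra_simps)
      moreover have "trade_cost M k i s l = l * v + ?L i x"
        using mid by (simp add: trade_cost_def v0 x_def)
      ultimately show ?thesis by simp
    next
      case stay
      have "l \<le> ?t (i - 1)" using stay anti[of "i - 1"] by (cases i) auto
      then have v0: "v = (real i + 1) * ?r - s" using stay by (auto simp: v)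
      have x0: "x = real (Suc i) * ?r" by (simp add: x_def v0 add.commute)
      have "l * x + V M (k + 1) x \<le> l * y + V M (k + 1) y" if "y \<ge> 0" for y
        using optimal_breakpoint[OF joined, of i l y] full[of i] stay that by (simp add: x0)
      moreover have "V M (k + 1) x = ?L (i + 1) x"
        using Vline[of x "i + 1"] rate_pos by (simp add: x0 segment_def)
      moreover have "x \<le> capacity M"
        using below_capacity[of "Suc i"] full[of i] stay by (simp add: x0)
      moreover have "v \<in> controls M s"
        using s' ri rate_pos by (auto simp: v0 controls_def max_def algebra_simps)
      moreover have "trade_cost M k i s l = l * v + ?L (i + 1) x"
        using stay \<open>l \<le> ?t (i - 1)\<close> by (simp add: trade_cost_def v0 x_def)
      ultimately show ?thesis by simp
    next
      case buy
      have le: "l \<le> ?t i" "l \<le> ?t (i - 1)"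
        using buy anti[of i] anti[of "i - 1"] by (cases i; simp)+
      then have v0: "v = ?r" using buy by (auto simp: v)
      have seg: "x \<in> segment M (i + 1)"
        using s' by (simp add: x_def v0 segment_def algebra_simps)
      have "l * x + V M (k + 1) x \<le> l * y + V M (k + 1) y" if "y \<ge> 0" "y \<le> s + ?r" for y
        using optimal_buy[OF joined, of "i + 1" l x y] full[of "i + 1"] buy that seg
        by (simp add: x_def v0 segment_def)
      moreover have "x \<le> capacity M"
        using below_capacity[of "i + 2"] full[of "i + 1"] buy seg by (simp add: segment_def)
      moreover have "v \<in> controls M s"
        using rate_pos s0 by (simp add: v0 controls_def)
      moreover have "trade_cost M k i s l = l * v + ?L (i + 1) x"
        using buy le by (auto simp: trade_cost_def v0 x_def)
      ultimately show ?thesis using Vline[OF seg] by simp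
    qed
  qed
  note main = this
  show "v \<in> controls M s" "l * v + V M (k + 1) (s + v) = trade_cost M k i s l"
    using main by (auto simp: x_def)
  show "s + v \<le> capacity M" if "s \<le> capacity M"
    using main that by (auto simp: x_def)
  assume "u \<in> controls M s"
  then have "s + u \<ge> 0" "s - ?r \<le> s + u" "s + u \<le> s + ?r"
    by (auto simp: controls_def)
  then have "l * x + V M (k + 1) x \<le> l * (s + u) + V M (k + 1) (s + u)"
    using main by blast
  then show "l * v + V M (k + 1) (s + v) \<le> l * u + V M (k + 1) (s + u)"
    by (simp add: x_def algebra_simps)
qed

lemma Bellman_minimum:
  assumes "well_shaped (k + 1)" "0 \<le> l" "s \<in> segment M i"
  shows "(INF v\<in>controls M s. l * v + V M (k + 1) (s + v)) = trade_cost M k i s l"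
proof (rule cInf_eq_minimum)
  show "trade_cost M k i s l \<in> (\<lambda>v. l * v + V M (k + 1) (s + v)) ` controls M s"
    using threshold_control_optimal(1,2)[OF assms] by (intro image_eqI) auto
  fix y assume "y \<in> (\<lambda>v. l * v + V M (k + 1) (s + v)) ` controls M s"
  then show "trade_cost M k i s l \<le> y"
    using threshold_control_optimal(2,3)[OF assms] by auto
qed

lemma V_expectation:
  assumes k: "k < horizon M" and next_shaped: "well_shaped (k + 1)" and s: "s \<in> segment M i"
  shows "has_bochner_integral (measure_pmf (price M k)) (\<lambda>l. penalty M k s + trade_cost M k i s l) (line M k i s)"
    and "V M k s = line M k i s"
proof -
  have "penalty M k s + (line M k i s - (slope M k i * s + icpt M k i)) = line M k i s"
    using penalty_piece[of k s i] k s by simp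
  moreover have "has_bochner_integral (measure_pmf (price M k)) (\<lambda>l. penalty M k s + trade_cost M k i s l)
      (penalty M k s + (line M k i s - (slope M k i * s + icpt M k i)))"
    using k by (intro has_expectation_intros line_expectation price_support well_shapedD(1)[OF next_shaped]) auto
  ultimately show ex: "has_bochner_integral (measure_pmf (price M k))
      (\<lambda>l. penalty M k s + trade_cost M k i s l) (line M k i s)"
    by (simp only:)
  have "has_bochner_integral (measure_pmf (price M k))
      (\<lambda>l. penalty M k s + (INF v\<in>controls M s. l * v + V M (k + 1) (s + v))) (line M k i s)"
  proof (rule has_expectation_cong[OF ex])
    fix l assume "l \<in> set_pmf (price M k)"
    then have "0 \<le> l" using price_nonneg[of k l] k by simp
    then show "penalty M k s + trade_cost M k i s l
        = penalty M k s + (INF v\<in>controls M s. l * v + V M (k + 1) (s + v))"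
      by (simp only: Bellman_minimum[OF next_shaped _ s])
  qed simp
  then show "V M k s = line M k i s"
    using k by (simp add: V.simps[of M k s] has_bochner_integral_iff)
qed

lemma well_shaped_upto_horizon: "k \<le> horizon M \<Longrightarrow> well_shaped k"
proof (induction k rule: inc_induct)
  case base
  show ?case by (rule well_shaped_horizon)
next
  case (step k)
  then have k: "k < horizon M" and nxt: "well_shaped (k + 1)" by auto
  show ?case
    unfolding well_shaped_def
    by (intro conjI allI impI ballI thresholds_decreasing_step[OF k nxt] thresholds_negative_step[OF k nxt]
      lines_meet_step[OF k nxt] V_expectation(2)[OF k nxt])
qed

end

section \<open>Verification of the threshold policy\<close>

text \<open>
  Feasible policies keep prices, controls and levels bounded only along the price paths in the support,
  so integrability is derived from boundedness on the support.
\<close>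

definition bounded_under :: "'a pmf \<Rightarrow> ('a \<Rightarrow> real) \<Rightarrow> bool" where
  "bounded_under p f \<longleftrightarrow> (\<exists>B. \<forall>x\<in>set_pmf p. \<bar>f x\<bar> \<le> B)"

lemma bounded_under_const: "bounded_under p (\<lambda>_. c)"
  unfolding bounded_under_def by blast

lemma bounded_under_add:
  assumes "bounded_under p f" "bounded_under p g"
  shows "bounded_under p (\<lambda>x. f x + g x)"
proof -
  obtain A B where "\<forall>x\<in>set_pmf p. \<bar>f x\<bar> \<le> A" "\<forall>x\<in>set_pmf p. \<bar>g x\<bar> \<le> B"
    using assms unfolding bounded_under_def by blast
  then have "\<forall>x\<in>set_pmf p. \<bar>f x + g x\<bar> \<le> A + B"
    by (meson abs_triangle_ineq add_mono order_trans)
  then show ?thesis unfolding bounded_under_def by blast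
qed

lemma bounded_under_mult:
  assumes "bounded_under p f" "bounded_under p g"
  shows "bounded_under p (\<lambda>x. f x * g x)"
proof -
  obtain A B where "\<forall>x\<in>set_pmf p. \<bar>f x\<bar> \<le> A" "\<forall>x\<in>set_pmf p. \<bar>g x\<bar> \<le> B"
    using assms unfolding bounded_under_def by blast
  then have "\<forall>x\<in>set_pmf p. \<bar>f x * g x\<bar> \<le> A * B"
    unfolding abs_mult by (meson abs_ge_zero mult_mono order_trans)
  then show ?thesis unfolding bounded_under_def by blast
qed

lemma bounded_under_sum:
  assumes "\<And>i. i \<in> I \<Longrightarrow> bounded_under p (f i)"
  shows "bounded_under p (\<lambda>x. \<Sum>i\<in>I. f i x)"
  using assms
  by (induction I rule: infinite_finite_induct) (auto intro: bounded_under_const bounded_under_add)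

lemma integrable_bounded_under: "bounded_under p f \<Longrightarrow> integrable (measure_pmf p) f"
  unfolding bounded_under_def using has_expectation[of p f] by (auto simp: has_bochner_integral_iff)

context storage_problem
begin

text \<open>
  The function $J_k(s)$ at the revealed price \<open>l\<close>, with the minimum already evaluated.
\<close>

definition cost_to_go :: "nat \<Rightarrow> real \<Rightarrow> real \<Rightarrow> real" where
  "cost_to_go k s l = penalty M k s + trade_cost M k (segment_of M s) s l"

text \<open>
  Only finitely many affine pieces meet the interval of feasible levels.
\<close>

lemma V_bounded:
  assumes "k \<le> horizon M"
  shows "\<exists>B. \<forall>s\<in>{0..capacity M}. \<bar>V M k s\<bar> \<le> B"
proof (intro exI ballI)
  fix s assume s: "s \<in> {0..capacity M}"
  define i where "i = segment_of M s"
  let ?b = "\<lambda>i. \<bar>thr M k i\<bar> * capacity M + \<bar>intercept M k i\<bar>"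
  have cap: "capacity M \<ge> 0" using rate_pos by (simp add: capacity_def)
  have seg: "s \<in> segment M i" using in_segment_of s by (simp add: i_def)
  then have "real i * rate M \<le> real (blocks M) * rate M"
    using s by (simp add: segment_def capacity_def)
  then have i: "i \<le> blocks M" using rate_pos by simp
  have "V M k s = - thr M k i * s + intercept M k i"
    using well_shapedD(5)[OF well_shaped_upto_horizon[OF assms] seg] by (simp add: line_def affine_piece_def)
  also have "\<bar>\<dots>\<bar> \<le> \<bar>thr M k i\<bar> * s + \<bar>intercept M k i\<bar>"
    using s abs_triangle_ineq[of "- thr M k i * s" "intercept M k i"] by (simp add: abs_mult)
  also have "\<dots> \<le> ?b i"
    using s by (simp add: mult_left_mono)
  also have "\<dots> \<le> (\<Sum>i\<le>blocks M. ?b i)"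
    using i cap by (intro member_le_sum) auto
  finally show "\<bar>V M k s\<bar> \<le> (\<Sum>i\<le>blocks M. ?b i)" .
qed

lemma price_path_support:
  "w \<in> set_pmf (price_path M) \<Longrightarrow> k < horizon M \<Longrightarrow> w k \<in> set_pmf (price M k)"
  by (auto simp: price_path_def set_Pi_pmf PiE_dflt_def)

lemma price_bounded:
  "k \<le> horizon M \<Longrightarrow> l \<in> set_pmf (price M k) \<Longrightarrow> \<bar>l\<bar> \<le> price_max M k"
  using price_nonneg[of k l] price_support[of k] by auto

lemma penalty_bounded:
  assumes "k \<le> horizon M" "s \<in> {0..capacity M}"
  shows "\<bar>penalty M k s\<bar> \<le> penalty M k (capacity M)"
  using assms penalty_nonneg[of k s] mono_onD[OF penalty_mono[of k], of s "capacity M"] by auto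

lemma threshold_control_admissible:
  assumes k: "k < horizon M" and l: "l \<in> set_pmf (price M k)" and s: "s \<in> {0..capacity M}"
  shows "threshold_control M k s l \<in> {- rate M..rate M}"
    and "s + threshold_control M k s l \<in> {0..capacity M}"
proof -
  have nxt: "well_shaped (k + 1)" using k by (intro well_shaped_upto_horizon) simp
  have "0 \<le> l" using price_nonneg[of k l] k l by simp
  note opt = threshold_control_optimal[OF nxt this in_segment_of, of s]
  show "threshold_control M k s l \<in> {- rate M..rate M}"
    "s + threshold_control M k s l \<in> {0..capacity M}"
    using opt(1,4) s by (auto simp: controls_def)
qed

text \<open>
  Equality holds for the threshold control and inequality for any other control; these are the two
  halves of the verification argument.
\<close>

lemma Bellman_inequality:
  assumes k: "k < horizon M" and l: "l \<in> set_pmf (price M k)" and s: "s \<ge> 0" and u: "u \<in> controls M s"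
  shows "cost_to_go k s l \<le> penalty M k s + l * u + V M (k + 1) (s + u)"
    and "cost_to_go k s l
      = penalty M k s + l * threshold_control M k s l + V M (k + 1) (s + threshold_control M k s l)"
proof -
  have nxt: "well_shaped (k + 1)" using k by (intro well_shaped_upto_horizon) simp
  have "0 \<le> l" using price_nonneg[of k l] k l by simp
  note opt = threshold_control_optimal[OF nxt this in_segment_of, of s]
  show "cost_to_go k s l
      = penalty M k s + l * threshold_control M k s l + V M (k + 1) (s + threshold_control M k s l)"
    using opt(2) s by (simp add: cost_to_go_def)
  then show "cost_to_go k s l \<le> penalty M k s + l * u + V M (k + 1) (s + u)"
    using opt(3)[of u] s u by simp
qed

lemma cost_to_go_bounded:
  assumes k: "k < horizon M"
  shows "\<exists>B. \<forall>s\<in>{0..capacity M}. \<forall>l\<in>set_pmf (price M k). \<bar>cost_to_go k s l\<bar> \<le> B"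
proof -
  obtain B where B: "\<forall>s\<in>{0..capacity M}. \<bar>V M (k + 1) s\<bar> \<le> B"
    using V_bounded[of "k + 1"] k by auto
  have "\<bar>cost_to_go k s l\<bar> \<le> penalty M k (capacity M) + price_max M k * rate M + B"
    if s: "s \<in> {0..capacity M}" and l: "l \<in> set_pmf (price M k)" for s l
  proof -
    define v where "v = threshold_control M k s l"
    have v: "\<bar>v\<bar> \<le> rate M" "s + v \<in> {0..capacity M}"
      using threshold_control_admissible[OF k l s] by (auto simp: v_def)
    have "rate M \<in> controls M s" using s rate_pos by (simp add: controls_def)
    then have "cost_to_go k s l = penalty M k s + l * v + V M (k + 1) (s + v)"
      using Bellman_inequality(2)[OF k l] s by (simp add: v_def)
    moreover have "\<bar>l * v\<bar> \<le> price_max M k * rate M"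
      unfolding abs_mult using price_bounded[of k l] k l v(1) by (intro mult_mono) auto
    moreover have "\<bar>V M (k + 1) (s + v)\<bar> \<le> B" using B v(2) by blast
    moreover have "\<bar>penalty M k s\<bar> \<le> penalty M k (capacity M)"
      using penalty_bounded[of k s] k s by simp
    ultimately show ?thesis by linarith
  qed
  then show ?thesis by blast
qed

lemma cost_to_go_expectation:
  assumes k: "k < horizon M" and s: "s \<ge> 0"
  shows "measure_pmf.expectation (price M k) (cost_to_go k s) = V M k s"
proof -
  have nxt: "well_shaped (k + 1)" using k by (intro well_shaped_upto_horizon) simp
  note ex = V_expectation[OF k nxt in_segment_of[OF s]]
  have "cost_to_go k s = (\<lambda>l. penalty M k s + trade_cost M k (segment_of M s) s l)"
    by (auto simp: cost_to_go_def)
  then show ?thesis using ex by (simp add: has_bochner_integral_iff)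
qed

definition incurred_cost :: "real \<Rightarrow> policy \<Rightarrow> nat \<Rightarrow> (nat \<Rightarrow> real) \<Rightarrow> real" where
  "incurred_cost s0 \<pi> k w = (\<Sum>j<k. penalty M j (level s0 \<pi> w j) + w j * \<pi> j w)"

text \<open>
  The level at stage \<open>k\<close> depends only on the prices before \<open>k\<close>, hence is independent of the price at \<open>k\<close>.
\<close>

lemma level_adapted:
  assumes "feasible_policy M s0 \<pi>" "k \<le> horizon M" "\<And>j. j < k \<Longrightarrow> w j = w' j"
  shows "level s0 \<pi> w k = level s0 \<pi> w' k"
  using assms(2,3)
proof (induction k)
  case (Suc k)
  have "\<forall>k<horizon M. \<forall>w w'. (\<forall>j\<le>k. w j = w' j) \<longrightarrow> \<pi> k w = \<pi> k w'"
    using assms(1) unfolding feasible_policy_def by blast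
  then have "\<pi> k w = \<pi> k w'" using Suc.prems by (meson Suc_le_lessD le_imp_less_Suc)
  then show ?case using Suc by simp
qed simp

lemma feasible_policyD:
  assumes "feasible_policy M s0 \<pi>" "w \<in> set_pmf (price_path M)"
  shows "k \<le> horizon M \<Longrightarrow> level s0 \<pi> w k \<in> {0..capacity M}"
    and "k < horizon M \<Longrightarrow> \<bar>\<pi> k w\<bar> \<le> rate M"
    and "k < horizon M \<Longrightarrow> \<pi> k w \<in> controls M (level s0 \<pi> w k)"
proof -
  have lev: "level s0 \<pi> w k \<in> {0..capacity M}" if "k \<le> horizon M" for k
    using assms that unfolding feasible_policy_def by blast
  have rat: "\<pi> k w \<in> {- rate M..rate M}" if "k < horizon M" for k
    using assms that unfolding feasible_policy_def by blast
  show "k \<le> horizon M \<Longrightarrow> level s0 \<pi> w k \<in> {0..capacity M}" by (rule lev)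
  show "k < horizon M \<Longrightarrow> \<bar>\<pi> k w\<bar> \<le> rate M" using rat[of k] by auto
  show "k < horizon M \<Longrightarrow> \<pi> k w \<in> controls M (level s0 \<pi> w k)"
    using rat[of k] lev[of "Suc k"] by (auto simp: controls_def)
qed

lemma incurred_cost_bounded:
  assumes pi: "feasible_policy M s0 \<pi>" and "k \<le> horizon M"
  shows "bounded_under (price_path M) (incurred_cost s0 \<pi> k)"
  unfolding incurred_cost_def
proof (intro bounded_under_sum bounded_under_add bounded_under_mult)
  fix j assume "j \<in> {..<k}"
  then have j: "j < horizon M" using assms(2) by simp
  show "bounded_under (price_path M) (\<lambda>w. penalty M j (level s0 \<pi> w j))"
    unfolding bounded_under_def using penalty_bounded[of j] feasible_policyD(1)[OF pi, of _ j] j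
    by (meson less_imp_le)
  show "bounded_under (price_path M) (\<lambda>w. w j)"
    unfolding bounded_under_def using price_bounded[of j] price_path_support[of _ j] j
    by (meson less_imp_le)
  show "bounded_under (price_path M) (\<pi> j)"
    unfolding bounded_under_def using feasible_policyD(2)[OF pi, of _ j] j by blast
qed

lemma V_level_bounded:
  assumes "feasible_policy M s0 \<pi>" "k \<le> horizon M"
  shows "bounded_under (price_path M) (\<lambda>w. V M k (level s0 \<pi> w k))"
proof -
  obtain B where "\<forall>s\<in>{0..capacity M}. \<bar>V M k s\<bar> \<le> B"
    using V_bounded[OF assms(2)] by blast
  then show ?thesis
    unfolding bounded_under_def using feasible_policyD(1)[OF assms(1) _ assms(2)] by blast
qed

text \<open>
  Since the level and the current price are independent, the expected cost-to-go after the price is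
  revealed equals the expected value before it is revealed.
\<close>

lemma cost_to_go_along_policy:
  assumes pi: "feasible_policy M s0 \<pi>" and k: "k < horizon M"
  shows "measure_pmf.expectation (price_path M) (\<lambda>w. cost_to_go k (level s0 \<pi> w k) (w k))
      = measure_pmf.expectation (price_path M) (\<lambda>w. V M k (level s0 \<pi> w k))"
    and "bounded_under (price_path M) (\<lambda>w. cost_to_go k (level s0 \<pi> w k) (w k))"
proof -
  obtain B where B: "\<forall>s\<in>{0..capacity M}. \<forall>l\<in>set_pmf (price M k). \<bar>cost_to_go k s l\<bar> \<le> B"
    using cost_to_go_bounded[OF k] by blast
  have lev: "level s0 \<pi> w k \<in> {0..capacity M}" if "w \<in> set_pmf (price_path M)" for w
    using feasible_policyD(1)[OF pi that, of k] k by simp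
  show "bounded_under (price_path M) (\<lambda>w. cost_to_go k (level s0 \<pi> w k) (w k))"
    unfolding bounded_under_def using B lev price_path_support[OF _ k] by blast
  have "measure_pmf.expectation (price_path M) (\<lambda>w. cost_to_go k (level s0 \<pi> w k) (w k))
      = measure_pmf.expectation (price_path M)
          (\<lambda>w. measure_pmf.expectation (price M k) (cost_to_go k (level s0 \<pi> w k)))"
    unfolding price_path_def
  proof (rule expectation_Pi_pmf_resample)
    show "cost_to_go k (level s0 \<pi> (w(k := y)) k) z = cost_to_go k (level s0 \<pi> w k) z" for w y z
      using level_adapted[OF pi, of k "w(k := y)" w] k by simp
    show "\<bar>cost_to_go k (level s0 \<pi> w k) y\<bar> \<le> B"
      if "w \<in> set_pmf (Pi_pmf {..<horizon M} 0 (price M))" "y \<in> set_pmf (price M k)" for w y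
      using B lev[of w] that by (simp add: price_path_def)
  qed (use k in auto)
  also have "\<dots> = measure_pmf.expectation (price_path M) (\<lambda>w. V M k (level s0 \<pi> w k))"
  proof (intro integral_cong_AE)
    show "AE w in price_path M. measure_pmf.expectation (price M k) (cost_to_go k (level s0 \<pi> w k))
        = V M k (level s0 \<pi> w k)"
      unfolding AE_measure_pmf_iff using cost_to_go_expectation[OF k] lev by auto
  qed auto
  finally show "measure_pmf.expectation (price_path M) (\<lambda>w. cost_to_go k (level s0 \<pi> w k) (w k))
      = measure_pmf.expectation (price_path M) (\<lambda>w. V M k (level s0 \<pi> w k))" .
qed

definition anticipated_cost :: "real \<Rightarrow> policy \<Rightarrow> nat \<Rightarrow> real" where
  "anticipated_cost s0 \<pi> k = measure_pmf.expectation (price_path M)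
     (\<lambda>w. incurred_cost s0 \<pi> k w + V M k (level s0 \<pi> w k))"

text \<open>
  Replacing \<open>V\<close> at stage \<open>k\<close> by the cost-to-go does not change the expectation, and the step to stage
  \<open>Suc k\<close> is then the Bellman inequality on each path.
\<close>

lemma anticipated_cost_mono:
  assumes pi: "feasible_policy M s0 \<pi>" and k: "k < horizon M"
  shows "anticipated_cost s0 \<pi> k \<le> anticipated_cost s0 \<pi> (Suc k)"
    and "(\<And>w. w \<in> set_pmf (price_path M) \<Longrightarrow> \<pi> k w = threshold_control M k (level s0 \<pi> w k) (w k))
      \<Longrightarrow> anticipated_cost s0 \<pi> k = anticipated_cost s0 \<pi> (Suc k)"
proof -
  let ?E = "measure_pmf.expectation (price_path M)"
  let ?L = "\<lambda>w. level s0 \<pi> w k"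
  note int = integrable_bounded_under
  note bounds = incurred_cost_bounded[OF pi] V_level_bounded[OF pi] cost_to_go_along_policy(2)[OF pi k]
  have eq: "anticipated_cost s0 \<pi> k = ?E (\<lambda>w. incurred_cost s0 \<pi> k w + cost_to_go k (?L w) (w k))"
    using k unfolding anticipated_cost_def
    by (subst (1 2) Bochner_Integration.integral_add)
      (auto intro!: int bounds simp: cost_to_go_along_policy(1)[OF pi k])
  have next_cost: "incurred_cost s0 \<pi> (Suc k) w + V M (Suc k) (level s0 \<pi> w (Suc k))
      = incurred_cost s0 \<pi> k w + (penalty M k (?L w) + w k * \<pi> k w + V M (k + 1) (?L w + \<pi> k w))" for w
    by (simp add: incurred_cost_def)
  have L0: "?L w \<ge> 0" if "w \<in> set_pmf (price_path M)" for w
    using feasible_policyD(1)[OF pi that, of k] k by simp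
  note bellman = Bellman_inequality[OF k price_path_support[OF _ k] L0 feasible_policyD(3)[OF pi _ k]]
  show "anticipated_cost s0 \<pi> k \<le> anticipated_cost s0 \<pi> (Suc k)"
    unfolding eq unfolding anticipated_cost_def
  proof (rule integral_mono_AE)
    show "AE w in price_path M. incurred_cost s0 \<pi> k w + cost_to_go k (?L w) (w k)
        \<le> incurred_cost s0 \<pi> (Suc k) w + V M (Suc k) (level s0 \<pi> w (Suc k))"
      unfolding AE_measure_pmf_iff next_cost using bellman(1) by (auto intro: add_left_mono)
  qed (use k in \<open>auto intro!: int bounds bounded_under_add simp del: level.simps\<close>)
  assume threshold: "\<And>w. w \<in> set_pmf (price_path M) \<Longrightarrow> \<pi> k w = threshold_control M k (?L w) (w k)"
  show "anticipated_cost s0 \<pi> k = anticipated_cost s0 \<pi> (Suc k)"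
    unfolding eq unfolding anticipated_cost_def
  proof (rule integral_cong_AE)
    show "AE w in price_path M. incurred_cost s0 \<pi> k w + cost_to_go k (?L w) (w k)
        = incurred_cost s0 \<pi> (Suc k) w + V M (Suc k) (level s0 \<pi> w (Suc k))"
      unfolding AE_measure_pmf_iff next_cost
    proof
      fix w assume w: "w \<in> set_pmf (price_path M)"
      show "incurred_cost s0 \<pi> k w + cost_to_go k (?L w) (w k)
        = incurred_cost s0 \<pi> k w + (penalty M k (?L w) + w k * \<pi> k w + V M (k + 1) (?L w + \<pi> k w))"
        using bellman(2)[OF w w w] threshold[OF w] by simp
    qed
  qed auto
qed

lemma anticipated_cost_0: "anticipated_cost s0 \<pi> 0 = V M 0 s0"
  by (simp add: anticipated_cost_def incurred_cost_def)

text \<open>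
  A feasible policy ends within the capacity, where the terminal value is the salvage value.
\<close>

lemma anticipated_cost_horizon:
  assumes pi: "feasible_policy M s0 \<pi>"
  shows "anticipated_cost s0 \<pi> (horizon M) = expected_cost M s0 \<pi>"
  unfolding anticipated_cost_def expected_cost_def
proof (rule integral_cong_AE)
  show "AE w in price_path M. incurred_cost s0 \<pi> (horizon M) w + V M (horizon M) (level s0 \<pi> w (horizon M))
      = (\<Sum>k<horizon M. penalty M k (level s0 \<pi> w k) + w k * \<pi> k w) - salvage M * level s0 \<pi> w (horizon M)"
    unfolding AE_measure_pmf_iff
    using feasible_policyD(1)[OF pi, of _ "horizon M"]
    by (auto simp: incurred_cost_def V.simps[of M "horizon M"] terminal_value_def)
qed auto

lemma expected_cost_ge_V:
  assumes pi: "feasible_policy M s0 \<pi>"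
  shows "V M 0 s0 \<le> expected_cost M s0 \<pi>"
proof -
  have "k \<le> horizon M \<Longrightarrow> V M 0 s0 \<le> anticipated_cost s0 \<pi> k" for k
  proof (induction k)
    case (Suc k)
    then show ?case using anticipated_cost_mono(1)[OF pi, of k] by simp
  qed (simp add: anticipated_cost_0)
  then show ?thesis using anticipated_cost_horizon[OF pi] by fastforce
qed

lemma threshold_level_eq: "level s0 (threshold_policy M s0) w k = threshold_level M s0 w k"
  by (induction k) (auto simp: threshold_policy_def)

lemma threshold_level_adapted:
  "(\<And>j. j < k \<Longrightarrow> w j = w' j) \<Longrightarrow> threshold_level M s0 w k = threshold_level M s0 w' k"
  by (induction k) auto

lemma threshold_policy_feasible:
  assumes s0: "s0 \<in> {0..capacity M}"
  shows "feasible_policy M s0 (threshold_policy M s0)"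
proof -
  have lev: "threshold_level M s0 w k \<in> {0..capacity M}"
    if "w \<in> set_pmf (price_path M)" "k \<le> horizon M" for w k
    using that(2)
  proof (induction k)
    case (Suc k)
    then show ?case
      using threshold_control_admissible(2)[of k "w k" "threshold_level M s0 w k"]
        price_path_support[OF that(1), of k] by simp
  qed (use s0 in simp)
  have "threshold_policy M s0 k w = threshold_policy M s0 k w'" if "\<forall>j\<le>k. w j = w' j" for k w w'
    using that threshold_level_adapted[of k w w' s0] by (simp add: threshold_policy_def)
  moreover have "threshold_policy M s0 k w \<in> {- rate M..rate M}"
    if "w \<in> set_pmf (price_path M)" "k < horizon M" for w k
    unfolding threshold_policy_def
    using that lev price_path_support by (intro threshold_control_admissible(1)) auto
  ultimately show ?thesis
    unfolding feasible_policy_def threshold_level_eq using lev by blast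
qed

lemma expected_cost_threshold_policy:
  assumes s0: "s0 \<in> {0..capacity M}"
  shows "expected_cost M s0 (threshold_policy M s0) = V M 0 s0"
proof -
  let ?\<pi> = "threshold_policy M s0"
  note pi = threshold_policy_feasible[OF s0]
  have "k \<le> horizon M \<Longrightarrow> anticipated_cost s0 ?\<pi> k = V M 0 s0" for k
  proof (induction k)
    case (Suc k)
    have "anticipated_cost s0 ?\<pi> k = anticipated_cost s0 ?\<pi> (Suc k)"
      using Suc.prems
      by (intro anticipated_cost_mono(2)[OF pi]) (auto simp: threshold_policy_def threshold_level_eq)
    then show ?case using Suc by simp
  qed (simp add: anticipated_cost_0)
  then show ?thesis using anticipated_cost_horizon[OF pi] by fastforce
qed

lemma threshold_policy_optimal:
  assumes "s0 \<in> {0..capacity M}"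
  shows "optimal_policy M s0 (threshold_policy M s0)"
  unfolding optimal_policy_def is_arg_min_def expected_cost_threshold_policy[OF assms]
  using threshold_policy_feasible[OF assms] expected_cost_ge_V by (auto simp: not_less)

lemma threshold_control_is_arg_min:
  assumes k: "k < horizon M" and "s \<ge> 0" and l: "l \<in> set_pmf (price M k)"
  shows "is_arg_min (\<lambda>v. l * v + V M (k + 1) (s + v)) (\<lambda>v. v \<in> controls M s) (threshold_control M k s l)"
proof -
  have nxt: "well_shaped (k + 1)" using k by (intro well_shaped_upto_horizon) simp
  have "0 \<le> l" using price_nonneg[of k l] k l by simp
  note opt = threshold_control_optimal[OF nxt this in_segment_of[OF assms(2)]]
  show ?thesis
    unfolding is_arg_min_def using opt(1,3) by (auto simp: not_less)
qed

lemma V_shape: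
  assumes "k \<le> horizon M"
  shows "s \<in> segment M i \<Longrightarrow> V M k s = - thr M k i * s + intercept M k i"
    and "thr M k (i + 1) \<le> thr M k i"
    and "convex_on {0..capacity M + rate M} (V M k)"
    and "flat_tail \<Longrightarrow> convex_on {0..} (V M k)"
proof -
  note shaped = well_shaped_upto_horizon[OF assms]
  interpret pieces "rate M" "thr M k" "intercept M k" "V M k"
    by (rule well_shaped_pieces[OF shaped])
  show "s \<in> segment M i \<Longrightarrow> V M k s = - thr M k i * s + intercept M k i"
    using well_shapedD(5)[OF shaped] by (simp add: line_def affine_piece_def)
  show "thr M k (i + 1) \<le> thr M k i"
    using well_shapedD(1)[OF shaped] by simp
  have "(real (blocks M) + 1) * rate M = capacity M + rate M"
    by (simp add: capacity_def algebra_simps)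
  then show "convex_on {0..capacity M + rate M} (V M k)"
    using convex_upto[OF joined_upto_blocks[OF shaped, of "blocks M"]] by simp
  show "flat_tail \<Longrightarrow> convex_on {0..} (V M k)"
    by (intro convex_if_joined joined_upto_blocks[OF shaped]) simp
qed

end

theorem theorem1:
  fixes M :: storage
  assumes "horizon M \<ge> 1"
    and "rate M > 0"
    and "blocks M \<ge> 1"
    and "\<And>k. k \<le> horizon M \<Longrightarrow> 0 \<le> price_min M k"
    and "\<And>k. k \<le> horizon M \<Longrightarrow> set_pmf (price M k) \<subseteq> {price_min M k..price_max M k}"
    and "salvage M \<in> {price_min M (horizon M)..price_max M (horizon M)}"
    and "\<And>k s. k \<le> horizon M \<Longrightarrow> s \<ge> 0 \<Longrightarrow> penalty M k s \<ge> 0"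
    and "\<And>k. k \<le> horizon M \<Longrightarrow> mono_on {0..} (penalty M k)"
    and "\<And>k. k \<le> horizon M \<Longrightarrow> convex_on {0..} (penalty M k)"
    and "\<And>k i s. k \<le> horizon M \<Longrightarrow> s \<in> segment M i \<Longrightarrow>
           penalty M k s = slope M k i * s + icpt M k i"
    and "\<And>k i. k \<le> horizon M \<Longrightarrow> i \<ge> blocks M \<Longrightarrow> slope M k i > price_max M k"
  shows
    "(\<forall>k<horizon M. \<forall>s\<ge>0. \<forall>l\<in>set_pmf (price M k).
        is_arg_min (\<lambda>v. l * v + V M (k + 1) (s + v)) (\<lambda>v. v \<in> controls M s)
          (threshold_control M k s l))
     \<and> (\<forall>s0\<in>{0..capacity M}. optimal_policy M s0 (threshold_policy M s0))
     \<and> (\<forall>k\<le>horizon M.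
          (\<forall>i. \<forall>s\<in>segment M i. V M k s = - thr M k i * s + intercept M k i)
          \<and> (\<forall>i. thr M k (i + 1) \<le> thr M k i)
          \<and> convex_on {0..capacity M + rate M} (V M k)
          \<and> ((\<forall>i\<ge>blocks M. slope M (horizon M) i = slope M (horizon M) (blocks M))
               \<longrightarrow> convex_on {0..} (V M k)))"
proof -
  interpret storage_problem M
    using assms by unfold_locales auto
  have flat: "flat_tail \<longleftrightarrow> (\<forall>i\<ge>blocks M. slope M (horizon M) i = slope M (horizon M) (blocks M))"
    by (rule flat_tail_def)
  show ?thesis
    unfolding flat[symmetric]
    by (intro conjI allI impI ballI threshold_control_is_arg_min threshold_policy_optimal V_shape)
qed

end
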